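(* Let $u_0$ satisfy Oleinik's conditions and suppose that for some $0<\varepsilon\ll1$ there is a constant $C_0=C_0(\varepsilon)$ with $$|u_0(y)-1|\le C_0\,e^{-\varepsilon y^2}\qquad\text{for all } y\ge 0 .$$ Let $[u,v]$ be the corresponding global solution of the steady pressure-free Prandtl system and $\bar u$ the Blasius flow. Then there is a constant $C>0$, depending on $\varepsilon$ and independent of $x$, such that for all $x>0$ $$\left\|u(x,\cdot)-\bar u(x,\cdot)\right\|_{L^\infty_y(0,\infty)}\le C\,(x+1)^{-1}.$$
   Context: Steady pressure-free Prandtl system: $uu_x+vu_y-u_{yy}=0$, $u_x+v_y=0$ in $D=\{0<x<\infty,\ 0<y<\infty\}$, with $u(x,0)=v(x,0)=0$, $u(0,y)=u_0(y)$, and $u(x,y)\to 1$ as $y\to\infty$. Oleinik's conditions on $u_0$: for some $\alpha\in(0,1)$, $u_0\in C^{2,\alpha}([0,\infty])$, $u_0(y)>0$ for $y>0$, $u_0(0)=0$, $u_0'(0)>0$, $u_0(y)\to1$ as $y\to\infty$, and $u_0''(y)=O(y^2)$ for small $y$. Under these conditions (Oleinik) there is a global classical solution $[u,v]$ such that for every fixed $X_0>0$: $u$ is bounded and continuous on $[0,X_0]\times[0,\infty)$ and $u>0$ for $y>0$; $u_y>m>0$ for $0<y<y_0$ for some constants $m,y_0$; $u_y,u_{yy}$ are bounded and continuous on $[0,X_0]\times[0,\infty)$; $u_x,v,v_y$ are locally bounded and continuous on $[0,X_0]\times[0,\infty)$. The letter $u$ denotes this solution. Blasius flow: $\bar u(x,y)=f'\!\left(\frac{y}{\sqrt{2(x+1)}}\right)$,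 where $f$ solves $f'''+ff''=0$ on $[0,\infty)$, $f(0)=f'(0)=0$, $f'(\infty)=1$. The datum $u_0$ is fixed before the constant $C$ is chosen. *)

theory Defs
  imports
    "HOL-Analysis.Analysis"
    "HOL-Library.Landau_Symbols"
    "HOL-Probability.Essential_Supremum"
begin

text \<open>
  Calculus on the closed half line \<open>[0, \<infinity>)\<close>: the derivative is one-sided at \<open>0\<close> and two-sided
  elsewhere; \<open>half_deriv g\<close> is meaningful on \<open>{0..}\<close> only, and depends only on \<open>g\<close> there.
\<close>

definition half_deriv :: "(real \<Rightarrow> real) \<Rightarrow> real \<Rightarrow> real" where
  "half_deriv g s = vector_derivative g (at s within {0..})"

definition Dx :: "(real \<Rightarrow> real \<Rightarrow> real) \<Rightarrow> real \<Rightarrow> real \<Rightarrow> real" where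
  "Dx w x y = half_deriv (\<lambda>\<xi>. w \<xi> y) x"

definition Dy :: "(real \<Rightarrow> real \<Rightarrow> real) \<Rightarrow> real \<Rightarrow> real \<Rightarrow> real" where
  "Dy w x y = half_deriv (w x) y"

text \<open>
  The class \<open>C\<^sup>2\<^sup>,\<^sup>\<alpha>([0, \<infinity>])\<close>: finite global \<open>C\<^sup>2\<^sup>,\<^sup>\<alpha>\<close> norm on \<open>[0, \<infinity>)\<close>. For a function with a
  limit at infinity, the uniform continuity of the second derivative forces the first two
  derivatives to tend to \<open>0\<close>, so regularity up to \<open>y = \<infinity>\<close> needs no separate clause.
\<close>

definition C2_holder :: "real \<Rightarrow> (real \<Rightarrow> real) \<Rightarrow> bool" where
  "C2_holder \<alpha> g \<longleftrightarrow>
     g differentiable_on {0..} \<and>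
     half_deriv g differentiable_on {0..} \<and>
     continuous_on {0..} (half_deriv (half_deriv g)) \<and>
     bounded (g ` {0..}) \<and>
     bounded (half_deriv g ` {0..}) \<and>
     bounded (half_deriv (half_deriv g) ` {0..}) \<and>
     (\<exists>H. \<forall>y\<ge>0. \<forall>z\<ge>0.
        \<bar>half_deriv (half_deriv g) y - half_deriv (half_deriv g) z\<bar> \<le> H * \<bar>y - z\<bar> powr \<alpha>)"

definition oleinik_datum :: "(real \<Rightarrow> real) \<Rightarrow> bool" where
  "oleinik_datum u0 \<longleftrightarrow>
     (\<exists>\<alpha>. 0 < \<alpha> \<and> \<alpha> < 1 \<and> C2_holder \<alpha> u0) \<and>
     (\<forall>y>0. u0 y > 0) \<and>
     u0 0 = 0 \<and>
     half_deriv u0 0 > 0 \<and>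
     (u0 \<longlongrightarrow> 1) at_top \<and>
     half_deriv (half_deriv u0) \<in> O[at_right 0](\<lambda>y. y\<^sup>2)"

definition prandtl_system ::
  "(real \<Rightarrow> real) \<Rightarrow> (real \<Rightarrow> real \<Rightarrow> real) \<Rightarrow> (real \<Rightarrow> real \<Rightarrow> real) \<Rightarrow> bool" where
  "prandtl_system u0 u v \<longleftrightarrow>
     (\<forall>x>0. \<forall>y>0. u x y * Dx u x y + v x y * Dy u x y - Dy (Dy u) x y = 0) \<and>
     (\<forall>x>0. \<forall>y>0. Dx u x y + Dy v x y = 0) \<and>
     (\<forall>x\<ge>0. u x 0 = 0 \<and> v x 0 = 0) \<and>
     (\<forall>y\<ge>0. u 0 y = u0 y) \<and>
     (\<forall>x>0. (u x \<longlongrightarrow> 1) at_top)"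

text \<open>
  The global classical solution provided by Oleinik's theorem. The differentiability clauses give
  meaning to the derivatives in the remaining ones; the constants \<open>m\<close> and \<open>y\<^sub>0\<close>, like all the
  bounds, may depend on \<open>X\<close>.
\<close>

definition oleinik_solution ::
  "(real \<Rightarrow> real) \<Rightarrow> (real \<Rightarrow> real \<Rightarrow> real) \<Rightarrow> (real \<Rightarrow> real \<Rightarrow> real) \<Rightarrow> bool" where
  "oleinik_solution u0 u v \<longleftrightarrow>
     prandtl_system u0 u v \<and>
     (\<forall>y\<ge>0. (\<lambda>x. u x y) differentiable_on {0..}) \<and>
     (\<forall>x\<ge>0. u x differentiable_on {0..} \<and> Dy u x differentiable_on {0..} \<and>
             v x differentiable_on {0..}) \<and>
     (\<forall>X>0.
        (\<forall>w \<in> {u, Dy u, Dy (Dy u)}.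
           bounded ((\<lambda>(x, y). w x y) ` ({0..X} \<times> {0..})) \<and>
           continuous_on ({0..X} \<times> {0..}) (\<lambda>(x, y). w x y)) \<and>
        (\<forall>w \<in> {Dx u, v, Dy v}.
           (\<forall>Y>0. bounded ((\<lambda>(x, y). w x y) ` ({0..X} \<times> {0..Y}))) \<and>
           continuous_on ({0..X} \<times> {0..}) (\<lambda>(x, y). w x y)) \<and>
        (\<forall>x\<in>{0..X}. \<forall>y>0. u x y > 0) \<and>
        (\<exists>m>0. \<exists>y0>0. \<forall>x\<in>{0..X}. \<forall>y. 0 < y \<and> y < y0 \<longrightarrow> Dy u x y > m))"

definition blasius_profile :: "(real \<Rightarrow> real) \<Rightarrow> bool" where
  "blasius_profile f \<longleftrightarrow>
     f differentiable_on {0..} \<and>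
     half_deriv f differentiable_on {0..} \<and>
     half_deriv (half_deriv f) differentiable_on {0..} \<and>
     (\<forall>s\<ge>0. half_deriv (half_deriv (half_deriv f)) s + f s * half_deriv (half_deriv f) s = 0) \<and>
     f 0 = 0 \<and>
     half_deriv f 0 = 0 \<and>
     (half_deriv f \<longlongrightarrow> 1) at_top"

definition blasius_flow :: "(real \<Rightarrow> real) \<Rightarrow> real \<Rightarrow> real \<Rightarrow> real" where
  "blasius_flow f x y = half_deriv f (y / sqrt (2 * (x + 1)))"

text \<open>The norm of \<open>L\<^sup>\<infinity>(0, \<infinity>)\<close>; it equals \<open>\<infinity>\<close> if \<open>g\<close> is unbounded or \<open>\<bar>g\<bar>\<close> is not measurable.\<close>

definition Linf_norm :: "(real \<Rightarrow> real) \<Rightarrow> ereal" where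
  "Linf_norm g = esssup (lebesgue_on {0<..}) (\<lambda>y. ereal \<bar>g y\<bar>)"

end

theory Submission imports Defs begin

text \<open>
  In von Mises variables, with the stream function \<open>\<psi>\<close> in place of \<open>y\<close>, the system becomes the scalar
  equation \<open>w\<^sub>x = sqrt w w\<^sub>\<psi>\<^sub>\<psi>\<close> for \<open>w = u\<^sup>2\<close>, which has a maximum principle. The Blasius flow of origin
  \<open>x = - A\<close> is the self-similar solution \<open>w = f'(\<eta>)\<^sup>2\<close> with \<open>f(\<eta>) = \<psi> / sqrt (2 (x + A))\<close>. Moving
  the origin changes it by \<open>O(1 / (x + 1))\<close> only, so \<open>A\<close> may be chosen freely: it is taken so large
  that the Gaussian tail of the datum is narrower than that of the Blasius profile.

  With this \<open>A\<close>, \<open>w \<ge> f'\<^sup>2\<close> initially (\<open>initial_sandwich\<close>), hence always (\<open>blasius_lower_bound\<close>).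
  From above no Blasius profile is available, since \<open>u\<^sub>0\<close> may exceed \<open>1\<close> or reach it too fast. The model is
  the \<open>A\<close>-derivative of \<open>f'\<^sup>2\<close> at fixed \<open>\<psi>\<close>: it equals \<open>- f f'' / (x + A)\<close>, it solves the linearised
  equation, and it decays at the desired rate with the Gaussian tail that the datum needs.
  Adding \<open>\<theta>(x) f f''\<close> to \<open>f'\<^sup>2\<close> gives a supersolution of the nonlinear equation provided that the
  ratio \<open>r = u / f'\<close> of the velocities on a streamline is known beforehand to tend to \<open>1\<close> at some
  algebraic rate. This is obtained in two cruder steps. Multiples of \<open>f'\<^sup>2\<close> by \<open>k \<ge> 1\<close> are
  supersolutions where \<open>w\<close> exceeds them, so \<open>r\<close> is bounded (\<open>blasius_multiple_upper_bound\<close>). With \<open>r \<le> R\<close>, the function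
  \<open>f'\<^sup>2 (1 + N (x + A)\<^sup>-\<^sup>c / (1 + b \<eta>\<^sup>2))\<close> is a supersolution for small \<open>b\<close> and \<open>c\<close>
  (\<open>weighted_decay\<close>). Then \<open>w - f'\<^sup>2 \<le> K f f'' / (x + A)\<close> follows (\<open>sharp_decay\<close>).

  Finally \<open>\<eta>\<^sub>y = r / sqrt (2 (x + A))\<close>, so that on each streamline \<open>\<eta>\<close> and \<open>y / sqrt (2 (x + A))\<close> differ
  by a relative error \<open>O(1 / (x + A))\<close>. As \<open>\<eta> f''(\<eta>)\<close> is bounded, this changes \<open>f'\<close> by
  \<open>O(1 / (x + A))\<close> (\<open>blasius_convergence\<close>).

  The change of variables is never inverted: barriers are functions of \<open>x\<close> and \<open>\<eta>\<close>, and they are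
  composed with \<open>\<eta>(x, y)\<close> and compared with \<open>u\<^sup>2\<close> in the original coordinates.
\<close>

section \<open>Calculus on the half line\<close>

lemma half_deriv_within:
  assumes "g differentiable_on {0..}" "0 \<le> s"
  shows "(g has_real_derivative half_deriv g s) (at s within {0..})"
  using assms unfolding differentiable_on_def half_deriv_def
  by (simp add: has_real_derivative_iff_has_vector_derivative vector_derivative_works)

lemma half_deriv_at:
  assumes "g differentiable_on {0..}" "0 < s"
  shows "(g has_real_derivative half_deriv g s) (at s)"
proof -
  have "s \<in> interior {0::real..}" using assms by (simp add: interior_real_atLeast)
  then have "at s within {0..} = at s" by (rule at_within_interior)
  then show ?thesis using half_deriv_within[OF assms(1), of s] assms(2) by simp
qed

lemma half_line_mono:
  fixes h h' :: "real \<Rightarrow> real"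
  assumes cont: "continuous_on {a..} h"
    and der: "\<And>s. a < s \<Longrightarrow> (h has_real_derivative h' s) (at s)"
    and nonneg: "\<And>s. a < s \<Longrightarrow> 0 \<le> h' s"
    and st: "a \<le> s" "s \<le> t"
  shows "h s \<le> h t"
proof (rule DERIV_nonneg_imp_increasing_open[OF st(2)])
  show "\<exists>y. DERIV h r :> y \<and> 0 \<le> y" if "s < r" "r < t" for r
    using der[of r] nonneg[of r] that st by force
  show "continuous_on {s..t} h" using cont st by (auto intro: continuous_on_subset)
qed

lemma half_line_compare:
  fixes g k g' k' :: "real \<Rightarrow> real"
  assumes "continuous_on {0..} g" "continuous_on {0..} k"
    and "\<And>s. 0 < s \<Longrightarrow> (g has_real_derivative g' s) (at s)"
    and "\<And>s. 0 < s \<Longrightarrow> (k has_real_derivative k' s) (at s)"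
    and "\<And>s. 0 < s \<Longrightarrow> g' s \<le> k' s"
    and "g 0 \<le> k 0" "0 \<le> s"
  shows "g s \<le> k s"
proof -
  have "k 0 - g 0 \<le> k s - g s"
    by (rule half_line_mono[where a = 0 and h = "\<lambda>s. k s - g s" and h' = "\<lambda>s. k' s - g' s"])
      (use assms in \<open>auto intro!: derivative_eq_intros continuous_intros\<close>)
  then show ?thesis using assms(6) by simp
qed

text \<open>
  A maximum over the strip may sit on its right end \<open>x = X\<close>, where only the difference quotients to
  the left compare values inside the strip.
\<close>

lemma derivative_nonneg_at_left_max:
  fixes g :: "real \<Rightarrow> real"
  assumes "(g has_real_derivative D) (at x)" "0 < x"
    and mx: "\<And>z. 0 \<le> z \<Longrightarrow> z \<le> x \<Longrightarrow> g z \<le> g x"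
  shows "0 \<le> D"
proof (rule ccontr)
  assume "\<not> 0 \<le> D"
  then obtain d where d: "d > 0" "\<forall>h>0. h < d \<longrightarrow> g x < g (x - h)"
    using DERIV_neg_dec_left[OF assms(1)] by force
  define h where "h = min (d/2) x"
  have "0 < h" "h < d" "h \<le> x" using d assms(2) by (auto simp: h_def)
  then show False using d(2) mx[of "x - h"] by force
qed

lemma second_derivative_test:
  fixes g g' :: "real \<Rightarrow> real"
  assumes der: "\<And>z. 0 < z \<Longrightarrow> (g has_real_derivative g' z) (at z)"
    and der2: "(g' has_real_derivative D) (at y)"
    and y: "0 < y" "y < n"
    and mx: "\<And>z. 0 < z \<Longrightarrow> z < n \<Longrightarrow> g z \<le> g y"
  shows "g' y = 0" "D \<le> 0"
proof -
  define d where "d = min y (n - y)"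
  have d: "d > 0" using y by (auto simp: d_def)
  show 0: "g' y = 0"
  proof (rule DERIV_local_max[OF der[OF y(1)] d])
    show "\<forall>z. \<bar>y - z\<bar> < d \<longrightarrow> g z \<le> g y"
      using mx unfolding d_def by (auto simp: abs_if split: if_splits)
  qed
  show "D \<le> 0"
  proof (rule ccontr)
    assume "\<not> D \<le> 0"
    then obtain e where e: "e > 0" "\<forall>h>0. h < e \<longrightarrow> g' y < g' (y + h)"
      using DERIV_pos_inc_right[OF der2] by force
    define h where "h = min (e/2) ((n-y)/2)"
    have h: "0 < h" "h < e" "y + h < n" using e y by (auto simp: h_def min_def field_simps)
    have "\<exists>z. y < z \<and> z < y + h \<and> g (y+h) - g y = (y + h - y) * g' z"
      using h y der by (intro MVT2) auto
    then obtain z where z: "y < z" "z < y + h" "g (y+h) - g y = h * g' z" by auto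
    have "g' z > 0" using e(2)[rule_format, of "z - y"] z h 0 by auto
    then have "h * g' z > 0" using h by simp
    then have "g (y+h) > g y" using z(3) by linarith
    then show False using mx[of "y + h"] h y by auto
  qed
qed

section \<open>A maximum principle on the half strip\<close>

text \<open>
  This is the Phragmen-Lindelof argument: \<open>p\<close> is merely bounded above as \<open>y \<rightarrow> \<infinity>\<close>, but subtracting a
  small multiple of the strict supersolution \<open>E\<close>, which grows with \<open>y\<close>, makes the supremum a maximum.
  The \<open>y\<close>-derivative vanishes there, which removes the first-order term whatever its coefficient.
\<close>

lemma parabolic_maximum_principle:
  fixes p px py pyy E Ex Ey Eyy u b :: "real \<Rightarrow> real \<Rightarrow> real"
  assumes pcont: "continuous_on ({0..X} \<times> {0..}) (\<lambda>(x,y). p x y)"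
    and Econt: "continuous_on ({0..X} \<times> {0..}) (\<lambda>(x,y). E x y)"
    and px: "\<And>x y. 0 < x \<Longrightarrow> x \<le> X \<Longrightarrow> 0 < y \<Longrightarrow> ((\<lambda>x. p x y) has_real_derivative px x y) (at x)"
    and py: "\<And>x y. 0 < x \<Longrightarrow> x \<le> X \<Longrightarrow> 0 < y \<Longrightarrow> (p x has_real_derivative py x y) (at y)"
    and pyy: "\<And>x y. 0 < x \<Longrightarrow> x \<le> X \<Longrightarrow> 0 < y \<Longrightarrow> (py x has_real_derivative pyy x y) (at y)"
    and Ex: "\<And>x y. 0 < x \<Longrightarrow> x \<le> X \<Longrightarrow> 0 < y \<Longrightarrow> ((\<lambda>x. E x y) has_real_derivative Ex x y) (at x)"
    and Ey: "\<And>x y. 0 < x \<Longrightarrow> x \<le> X \<Longrightarrow> 0 < y \<Longrightarrow> (E x has_real_derivative Ey x y) (at y)"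
    and Eyy: "\<And>x y. 0 < x \<Longrightarrow> x \<le> X \<Longrightarrow> 0 < y \<Longrightarrow> (Ey x has_real_derivative Eyy x y) (at y)"
    and u: "\<And>x y. 0 < x \<Longrightarrow> x \<le> X \<Longrightarrow> 0 < y \<Longrightarrow> 0 \<le> u x y"
    and E0: "\<And>x y. 0 \<le> x \<Longrightarrow> x \<le> X \<Longrightarrow> 0 \<le> y \<Longrightarrow> 0 \<le> E x y"
    and grow: "\<And>K. \<exists>Y. \<forall>x\<in>{0..X}. \<forall>y\<ge>Y. K \<le> E x y"
    and pbd: "\<And>x y. 0 \<le> x \<Longrightarrow> x \<le> X \<Longrightarrow> 0 \<le> y \<Longrightarrow> p x y \<le> K"
    and Esuper: "\<And>x y. 0 < x \<Longrightarrow> x \<le> X \<Longrightarrow> 0 < y \<Longrightarrow>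
        0 < u x y * Ex x y + b x y * Ey x y - Eyy x y"
    and psub: "\<And>x y. 0 < x \<Longrightarrow> x \<le> X \<Longrightarrow> 0 < y \<Longrightarrow> 0 < p x y \<Longrightarrow>
        u x y * px x y + b x y * py x y - pyy x y \<le> 0"
    and initial: "\<And>y. 0 \<le> y \<Longrightarrow> p 0 y \<le> 0"
    and wall: "\<And>x. 0 \<le> x \<Longrightarrow> x \<le> X \<Longrightarrow> p x 0 \<le> 0"
    and xy: "0 \<le> x1" "x1 \<le> X" "0 \<le> y1"
  shows "p x1 y1 \<le> 0"
proof (rule ccontr)
  assume "\<not> p x1 y1 \<le> 0"
  then have pos: "p x1 y1 > 0" by simp
  have E1: "E x1 y1 \<ge> 0" using E0 xy by simp
  (* e is small enough for p - e * E to stay positive at (x1, y1) *)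
  define e where "e = p x1 y1 / (2 * (E x1 y1 + 1))"
  have e: "e > 0" using pos E1 by (simp add: e_def)
  have "e * E x1 y1 \<le> p x1 y1 / 2"
    using pos E1 by (simp add: e_def field_simps)
  then have pos': "p x1 y1 - e * E x1 y1 > 0" using pos by linarith
  obtain Y where Y: "\<And>x y. x \<in> {0..X} \<Longrightarrow> y \<ge> Y \<Longrightarrow> K / e \<le> E x y" using grow[of "K/e"] by blast
  define n where "n = max Y y1 + 1"
  let ?q = "\<lambda>x y. p x y - e * E x y"
  let ?S = "{0..X} \<times> {0..n}"
  have "continuous_on ({0..X} \<times> {0..}) (\<lambda>z. (case z of (x,y) \<Rightarrow> p x y) - e * (case z of (x,y) \<Rightarrow> E x y))"
    by (intro continuous_intros pcont Econt)
  then have "continuous_on ?S (\<lambda>z. (case z of (x,y) \<Rightarrow> p x y) - e * (case z of (x,y) \<Rightarrow> E x y))"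
    by (rule continuous_on_subset) auto
  moreover have "compact ?S" by (intro compact_Times compact_Icc)
  moreover have in1: "(x1,y1) \<in> ?S" using xy by (auto simp: n_def)
  ultimately obtain z where z: "z \<in> ?S" and zmax:
    "\<And>w. w \<in> ?S \<Longrightarrow> (\<lambda>z. (case z of (x,y) \<Rightarrow> p x y) - e * (case z of (x,y) \<Rightarrow> E x y)) w
        \<le> (\<lambda>z. (case z of (x,y) \<Rightarrow> p x y) - e * (case z of (x,y) \<Rightarrow> E x y)) z"
    using continuous_attains_sup[of ?S "\<lambda>z. (case z of (x,y) \<Rightarrow> p x y) - e * (case z of (x,y) \<Rightarrow> E x y)"]
    by blast
  obtain x0 y0 where z0: "z = (x0,y0)" by force
  have mem: "0 \<le> x0" "x0 \<le> X" "0 \<le> y0" "y0 \<le> n" using z z0 by auto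
  have mx: "?q x y \<le> ?q x0 y0" if "0 \<le> x" "x \<le> X" "0 \<le> y" "y \<le> n" for x y
    using zmax[of "(x,y)"] that z0 by auto
  have q0: "?q x0 y0 > 0" using mx[of x1 y1] pos' xy by (force simp: n_def)
  have Enn: "E x0 y0 \<ge> 0" using E0 mem by simp
  then have p0: "p x0 y0 > 0" using q0 e by (smt (verit) mult_nonneg_nonneg)
  have x0: "0 < x0" using p0 initial[of y0] mem by (cases "x0 = 0") auto
  have y0: "0 < y0" using p0 wall[of x0] mem by (cases "y0 = 0") auto
  have "y0 < Y"
  proof (rule ccontr)
    assume "\<not> y0 < Y"
    then have "K / e \<le> E x0 y0" using Y mem by auto
    then have "K \<le> e * E x0 y0" using e by (simp add: field_simps)
    then show False using q0 pbd[of x0 y0] mem by linarith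
  qed
  then have yn: "y0 < n" by (simp add: n_def)
  have dx: "0 \<le> px x0 y0 - e * Ex x0 y0"
  proof (rule derivative_nonneg_at_left_max[where g = "\<lambda>x. ?q x y0"])
    show "((\<lambda>x. ?q x y0) has_real_derivative px x0 y0 - e * Ex x0 y0) (at x0)"
      using mem x0 y0 by (auto intro!: derivative_eq_intros px Ex)
  qed (use x0 mx mem in auto)
  have der: "((\<lambda>y. ?q x0 y) has_real_derivative py x0 y - e * Ey x0 y) (at y)" if "0 < y" for y
    using mem x0 that by (auto intro!: derivative_eq_intros py Ey)
  have der2: "((\<lambda>y. py x0 y - e * Ey x0 y) has_real_derivative pyy x0 y0 - e * Eyy x0 y0) (at y0)"
    using mem x0 y0 by (auto intro!: derivative_eq_intros pyy Eyy)
  have mxy: "?q x0 y \<le> ?q x0 y0" if "0 < y" "y < n" for y using mx[of x0 y] that mem by auto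
  have dy: "py x0 y0 - e * Ey x0 y0 = 0" and dyy: "pyy x0 y0 - e * Eyy x0 y0 \<le> 0"
    using second_derivative_test[OF der der2 y0 yn mxy] by auto
  have "0 \<le> u x0 y0 * (px x0 y0 - e * Ex x0 y0) + b x0 y0 * (py x0 y0 - e * Ey x0 y0)
      - (pyy x0 y0 - e * Eyy x0 y0)"
    using mult_nonneg_nonneg[OF u[OF x0 mem(2) y0] dx] dy dyy by simp
  also have "\<dots> = (u x0 y0 * px x0 y0 + b x0 y0 * py x0 y0 - pyy x0 y0)
      - e * (u x0 y0 * Ex x0 y0 + b x0 y0 * Ey x0 y0 - Eyy x0 y0)"
    by (simp add: algebra_simps)
  also have "\<dots> < 0"
    using psub[OF x0 mem(2) y0 p0] mult_pos_pos[OF e Esuper[OF x0 mem(2) y0]] by linarith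
  finally show False by simp
qed

section \<open>The Blasius profile\<close>

locale blasius =
  fixes f :: "real \<Rightarrow> real"
  assumes profile: "blasius_profile f"
begin

abbreviation f1 :: "real \<Rightarrow> real" where "f1 \<equiv> half_deriv f"
abbreviation f2 :: "real \<Rightarrow> real" where "f2 \<equiv> half_deriv f1"

lemma f_0 [simp]: "f 0 = 0" and f1_0 [simp]: "f1 0 = 0" and f1_limit: "(f1 \<longlongrightarrow> 1) at_top"
  using profile by (auto simp: blasius_profile_def)

lemma
  assumes "0 \<le> s"
  shows f_within: "(f has_real_derivative f1 s) (at s within {0..})"
    and f1_within: "(f1 has_real_derivative f2 s) (at s within {0..})"
    and f2_within: "(f2 has_real_derivative - f s * f2 s) (at s within {0..})"
proof -
  have "half_deriv f2 s = - f s * f2 s" using profile assms by (force simp: blasius_profile_def)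
  then show "(f has_real_derivative f1 s) (at s within {0..})"
    "(f1 has_real_derivative f2 s) (at s within {0..})"
    "(f2 has_real_derivative - f s * f2 s) (at s within {0..})"
    using half_deriv_within[of f s] half_deriv_within[of f1 s] half_deriv_within[of f2 s]
      assms profile by (auto simp: blasius_profile_def)
qed

lemma
  assumes "0 < s"
  shows f_deriv: "(f has_real_derivative f1 s) (at s)"
    and f1_deriv: "(f1 has_real_derivative f2 s) (at s)"
    and f2_deriv: "(f2 has_real_derivative - f s * f2 s) (at s)"
proof -
  have "s \<in> interior {0::real..}" using assms by (simp add: interior_real_atLeast)
  then have "at s within {0..} = at s" by (rule at_within_interior)
  then show "(f has_real_derivative f1 s) (at s)" "(f1 has_real_derivative f2 s) (at s)"
    "(f2 has_real_derivative - f s * f2 s) (at s)"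
    using f_within[of s] f1_within[of s] f2_within[of s] assms by auto
qed

lemma f_cont: "continuous_on {0..} f" and f1_cont: "continuous_on {0..} f1"
  and f2_cont: "continuous_on {0..} f2"
  by (rule DERIV_continuous_on, rule f_within f1_within f2_within, simp)+

lemmas profile_cont [continuous_intros] =
  continuous_on_compose2[OF f_cont] continuous_on_compose2[OF f1_cont]
  continuous_on_compose2[OF f2_cont]

text \<open>
  The equation is linear in \<open>f''\<close>, with solution \<open>f''(0) exp (- \<integral> f)\<close>. So \<open>f''\<close> has one sign, and
  a non-positive \<open>f''\<close> would keep \<open>f'\<close> from reaching \<open>1\<close>.
\<close>

lemma f2_pos: "0 \<le> s \<Longrightarrow> 0 < f2 s"
proof -
  define I where "I s = integral {0..s} f" for s
  have I: "(I has_real_derivative f s) (at s)" if "0 < s" for s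
  proof -
    have "continuous_on {0..s+1} f" by (rule continuous_on_subset[OF f_cont]) auto
    then have "(I has_real_derivative f s) (at s within {0..s+1})"
      unfolding I_def by (rule integral_has_real_derivative) (use that in auto)
    moreover have "s \<in> interior {0..s+1}" using that by (simp add: interior_atLeastAtMost_real)
    ultimately show ?thesis using at_within_interior by metis
  qed
  have Icont: "continuous_on {0..s} I" for s
    unfolding I_def
    by (rule indefinite_integral_continuous_1, rule integrable_continuous_real,
        rule continuous_on_subset[OF f_cont]) auto
  have const: "f2 s * exp (I s) = f2 0 * exp (I 0)" if "0 < s" for s
  proof (rule DERIV_isconst_end[OF that])
    show "continuous_on {0..s} (\<lambda>s. f2 s * exp (I s))"
      by (intro continuous_intros Icont) (auto intro: continuous_on_subset[OF f2_cont])
    show "((\<lambda>s. f2 s * exp (I s)) has_real_derivative 0) (at r)" if "0 < r" "r < s" for r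
      using that by (auto intro!: derivative_eq_intros I f2_deriv simp: algebra_simps)
  qed
  have I0: "I 0 = 0" by (simp add: I_def)
  have f2_eq: "f2 s = f2 0 * exp (- I s)" if "0 \<le> s" for s
    using const[of s] I0 that by (cases "s = 0") (auto simp: exp_minus field_simps)
  have "0 < f2 0"
  proof (rule ccontr)
    assume neg: "\<not> 0 < f2 0"
    have "f1 s \<le> 0" if "0 \<le> s" for s
    proof -
      have "- f1 0 \<le> - f1 s"
      proof (rule half_line_mono[where h = "\<lambda>s. - f1 s" and h' = "\<lambda>s. - f2 s" and a = 0])
        show "0 \<le> - f2 r" if "0 < r" for r
          using f2_eq[of r] neg that by (simp add: mult_nonpos_nonneg)
      qed (use that in \<open>auto intro!: derivative_eq_intros continuous_intros f1_cont f1_deriv\<close>)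
      then show ?thesis by simp
    qed
    then have "eventually (\<lambda>s. f1 s \<le> 0) at_top" by (intro eventually_at_top_linorderI[of 0])
    then have "(1::real) \<le> 0" by (rule tendsto_upperbound[OF f1_limit]) simp
    then show False by simp
  qed
  then show "0 < f2 s" if "0 \<le> s" using f2_eq[OF that] by simp
qed

lemma f1_mono: "0 \<le> s \<Longrightarrow> s \<le> t \<Longrightarrow> f1 s \<le> f1 t"
  by (rule half_line_mono[where h = f1 and h' = f2 and a = 0])
    (auto intro: f1_cont f1_deriv less_imp_le[OF f2_pos])

lemma f1_nonneg: "0 \<le> s \<Longrightarrow> 0 \<le> f1 s"
  using f1_mono[of 0 s] by simp

lemma f1_pos: "0 < s \<Longrightarrow> 0 < f1 s"
proof -
  assume s: "0 < s"
  have "\<exists>z. 0 < z \<and> z < s \<and> f1 s - f1 0 = (s - 0) * f2 z"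
  proof -
    have "continuous_on {0..s} f1" by (rule continuous_on_subset[OF f1_cont]) auto
    moreover have "(f1 has_real_derivative f2 x) (at x)" if "0 < x" "x < s" for x
      using that f1_deriv by auto
    ultimately obtain l z where "0 < z" "z < s" "DERIV f1 z :> l" "f1 s - f1 0 = (s - 0) * l"
      using MVT[of 0 s f1] s by (auto simp: real_differentiable_def)
    moreover have "DERIV f1 z :> f2 z" using f1_deriv[of z] calculation(1) by simp
    ultimately show ?thesis using DERIV_unique by blast
  qed
  then show ?thesis using f2_pos s by fastforce
qed

lemma f1_le_1: "0 \<le> s \<Longrightarrow> f1 s \<le> 1"
proof -
  assume s: "0 \<le> s"
  have "eventually (\<lambda>t. f1 s \<le> f1 t) at_top"
    by (rule eventually_at_top_linorderI[of s]) (rule f1_mono[OF s])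
  then show ?thesis using tendsto_lowerbound[OF f1_limit] by simp
qed

lemma f_mono: "0 \<le> s \<Longrightarrow> s \<le> t \<Longrightarrow> f s \<le> f t"
  by (rule half_line_mono[where h = f and h' = f1 and a = 0])
    (auto intro: f_cont f_deriv less_imp_le[OF f1_pos])

lemma f_nonneg: "0 \<le> s \<Longrightarrow> 0 \<le> f s"
  using f_mono[of 0 s] by simp

lemma f_strict_mono: "0 \<le> s \<Longrightarrow> s < t \<Longrightarrow> f s < f t"
proof -
  assume s: "0 \<le> s" and t: "s < t"
  have "f s < f t"
  proof (rule DERIV_pos_imp_increasing_open[OF t])
    show "\<exists>y. DERIV f x :> y \<and> 0 < y" if "s < x" "x < t" for x
      using that s f_deriv[of x] f1_pos[of x] by auto
    show "continuous_on {s..t} f" using f_cont s by (auto intro: continuous_on_subset)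
  qed
  then show ?thesis .
qed

lemma f_pos: "0 < s \<Longrightarrow> 0 < f s"
  using f_strict_mono[of 0 s] by simp

lemma f2_antimono: "0 \<le> s \<Longrightarrow> s \<le> t \<Longrightarrow> f2 t \<le> f2 s"
proof -
  assume *: "0 \<le> s" "s \<le> t"
  have "- f2 s \<le> - f2 t"
    by (rule half_line_mono[where h = "\<lambda>r. - f2 r" and h' = "\<lambda>r. f r * f2 r" and a = 0])
      (use * in \<open>auto intro!: derivative_eq_intros continuous_intros f2_cont f2_deriv
         mult_nonneg_nonneg f_nonneg less_imp_le[OF f2_pos]\<close>)
  then show ?thesis by simp
qed

lemma f1_le: "0 \<le> s \<Longrightarrow> f1 s \<le> f2 0 * s"
proof (rule half_line_compare[where g = "f1" and k = "\<lambda>s. f2 0 * s"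
      and g' = "f2" and k' = "\<lambda>s. f2 0"])
  show "(f2) r \<le> (\<lambda>s. f2 0) r" if "0 < r" for r
    using f2_antimono[of 0 r] that by simp
qed (auto intro!: derivative_eq_intros continuous_intros f_cont f1_cont f2_cont f_deriv f1_deriv f2_deriv
      simp: algebra_simps power2_eq_square)

lemma f_le: "0 \<le> s \<Longrightarrow> f s \<le> s"
proof (rule half_line_compare[where g = "f" and k = "\<lambda>s. s"
      and g' = "f1" and k' = "\<lambda>s. 1"])
  show "(f1) r \<le> (\<lambda>s. 1) r" if "0 < r" for r
    using f1_le_1[of r] that by simp
qed (auto intro!: derivative_eq_intros continuous_intros f_cont f1_cont f2_cont f_deriv f1_deriv f2_deriv
      simp: algebra_simps power2_eq_square)

lemma f_le_f1: "0 \<le> s \<Longrightarrow> f s \<le> s * f1 s"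
proof (rule half_line_compare[where g = "f" and k = "\<lambda>s. s * f1 s"
      and g' = "f1" and k' = "\<lambda>s. f1 s + s * f2 s"])
  show "(f1) r \<le> (\<lambda>s. f1 s + s * f2 s) r" if "0 < r" for r
    using f2_pos[of r] that by simp
qed (auto intro!: derivative_eq_intros continuous_intros f_cont f1_cont f2_cont f_deriv f1_deriv f2_deriv
      simp: algebra_simps power2_eq_square)

lemma f2_le_f1: "0 \<le> s \<Longrightarrow> s * f2 s \<le> f1 s"
proof (rule half_line_compare[where g = "\<lambda>s. s * f2 s" and k = "f1"
      and g' = "\<lambda>s. f2 s - s * f s * f2 s" and k' = "f2"])
  show "(\<lambda>s. f2 s - s * f s * f2 s) r \<le> (f2) r" if "0 < r" for r
    using f2_pos[of r] f_pos[of r] that by simp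
qed (auto intro!: derivative_eq_intros continuous_intros f_cont f1_cont f2_cont f_deriv f1_deriv f2_deriv
      simp: algebra_simps power2_eq_square)

text \<open>
  The derivative of \<open>f'\<^sup>2 - f f''\<close> is \<open>f' f'' + f\<^sup>2 f'' \<ge> 0\<close>. This is the inequality that compares the
  linearised mode \<open>f f''\<close> with \<open>f'\<^sup>2\<close>.
\<close>

lemma f_f2_le: "0 \<le> s \<Longrightarrow> f s * f2 s \<le> (f1 s)\<^sup>2"
proof (rule half_line_compare[where g = "\<lambda>s. f s * f2 s" and k = "\<lambda>s. (f1 s)\<^sup>2"
      and g' = "\<lambda>s. f1 s * f2 s - (f s)\<^sup>2 * f2 s" and k' = "\<lambda>s. 2 * f1 s * f2 s"])
  show "(\<lambda>s. f1 s * f2 s - (f s)\<^sup>2 * f2 s) r \<le> (\<lambda>s. 2 * f1 s * f2 s) r" if "0 < r" for r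
    proof -
    have "0 \<le> (f r)\<^sup>2 * f2 r" "0 \<le> f1 r * f2 r"
      using f2_pos[of r] f1_pos[of r] that by auto
    then show ?thesis by simp
  qed
qed (auto intro!: derivative_eq_intros continuous_intros f_cont f1_cont f2_cont f_deriv f1_deriv f2_deriv
      simp: algebra_simps power2_eq_square)

lemma f1_square_le: "0 \<le> s \<Longrightarrow> (f1 s)\<^sup>2 \<le> 2 * f2 0 * f s"
proof (rule half_line_compare[where g = "\<lambda>s. (f1 s)\<^sup>2" and k = "\<lambda>s. 2 * f2 0 * f s"
      and g' = "\<lambda>s. 2 * f1 s * f2 s" and k' = "\<lambda>s. 2 * f2 0 * f1 s"])
  show "(\<lambda>s. 2 * f1 s * f2 s) r \<le> (\<lambda>s. 2 * f2 0 * f1 s) r" if "0 < r" for r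
    using f2_antimono[of 0 r] f1_pos[of r] that by (simp add: mult.commute)
qed (auto intro!: derivative_eq_intros continuous_intros f_cont f1_cont f2_cont f_deriv f1_deriv f2_deriv
      simp: algebra_simps power2_eq_square)

lemma f_linear_lower:
  assumes "0 < a" "a \<le> s" shows "f a / a * s \<le> f s"
proof -
  have "f a / a \<le> f s / s"
  proof (rule half_line_mono[where a = a and h = "\<lambda>s. f s / s" and h' = "\<lambda>s. (s * f1 s - f s) / s\<^sup>2"])
    show "((\<lambda>s. f s / s) has_real_derivative (r * f1 r - f r) / r\<^sup>2) (at r)" if "a < r" for r
      using that assms by (auto intro!: derivative_eq_intros f_deriv simp: power2_eq_square algebra_simps)
    show "continuous_on {a..} (\<lambda>s. f s / s)" using assms by (auto intro!: continuous_intros)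
    show "0 \<le> (r * f1 r - f r) / r\<^sup>2" if "a < r" for r using f_le_f1[of r] that assms by simp
  qed (use assms in auto)
  then show ?thesis using assms by (simp add: field_simps)
qed

lemma f_tangent: "0 \<le> s \<Longrightarrow> f1 1 * (s - 1) \<le> f s"
proof (cases "s \<ge> 1")
  case True
  have "f 1 - f1 1 * (1 - 1) \<le> f s - f1 1 * (s - 1)"
    by (rule half_line_mono[where a = 1 and h = "\<lambda>s. f s - f1 1 * (s - 1)" and h' = "\<lambda>s. f1 s - f1 1"])
      (use True in \<open>auto intro!: derivative_eq_intros continuous_intros f_deriv f1_mono\<close>)
  then show ?thesis using f_nonneg[of 1] by simp
next
  case False
  assume s: "0 \<le> s"
  have "f1 1 * (s - 1) \<le> 0" using False f1_nonneg[of 1] by (simp add: mult_nonneg_nonpos)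
  then show ?thesis using f_nonneg[OF s] by linarith
qed

lemma f2_gauss_lower:
  assumes "0 \<le> s" shows "f2 0 * exp (- (s\<^sup>2 / 2)) \<le> f2 s"
proof -
  have "f2 0 * exp (0\<^sup>2/2) \<le> f2 s * exp (s\<^sup>2/2)"
  proof (rule half_line_mono[where a = 0 and h = "\<lambda>s. f2 s * exp (s\<^sup>2/2)" and h' = "\<lambda>s. (s - f s) * (f2 s * exp (s\<^sup>2/2))"])
    show "0 \<le> (r - f r) * (f2 r * exp (r\<^sup>2/2))" if "0 < r" for r
      using f_le[of r] f2_pos[of r] that by simp
  qed (use assms in \<open>auto intro!: derivative_eq_intros continuous_intros f2_cont f2_deriv simp: algebra_simps\<close>)
  then show ?thesis by (simp add: exp_minus field_simps)
qed

lemma f2_gauss_upper: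
  assumes "1 \<le> s" shows "f2 s \<le> f2 1 * exp (f 1 / 2) * exp (- (f 1 * s\<^sup>2 / 2))"
proof -
  have "- (f2 1 * exp (f 1 * 1\<^sup>2/2)) \<le> - (f2 s * exp (f 1 * s\<^sup>2/2))"
  proof (rule half_line_mono[where a = 1 and h = "\<lambda>s. - (f2 s * exp (f 1 * s\<^sup>2/2))" and h' = "\<lambda>s. (f s - f 1 * s) * (f2 s * exp (f 1 * s\<^sup>2/2))"])
    show "0 \<le> (f r - f 1 * r) * (f2 r * exp (f 1 * r\<^sup>2/2))" if "1 < r" for r
      using f_linear_lower[of 1 r] f2_pos[of r] that by simp
  qed (use assms in \<open>auto intro!: derivative_eq_intros continuous_intros f2_deriv simp: algebra_simps\<close>)
  then show ?thesis by (simp add: exp_minus field_simps)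
qed

lemma f1_deficit_lower:
  assumes "0 \<le> s" shows "f2 0 * exp (- ((s + 1)\<^sup>2 / 2)) \<le> 1 - f1 s"
proof -
  have "\<exists>z. s < z \<and> z < s + 1 \<and> f1 (s+1) - f1 s = (s + 1 - s) * f2 z"
  proof -
    have "continuous_on {s..s+1} f1" by (rule continuous_on_subset[OF f1_cont]) (use assms in auto)
    moreover have "(f1 has_real_derivative f2 x) (at x)" if "s < x" "x < s + 1" for x
      using that f1_deriv assms by auto
    ultimately obtain l z where "s < z" "z < s + 1" "DERIV f1 z :> l" "f1 (s+1) - f1 s = (s + 1 - s) * l"
      using MVT[of s "s+1" f1] by (auto simp: real_differentiable_def)
    moreover have "DERIV f1 z :> f2 z" using f1_deriv[of z] calculation(1) assms by simp
    ultimately show ?thesis using DERIV_unique by blast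
  qed
  then obtain z where z: "s < z" "z < s+1" "f1 (s+1) - f1 s = f2 z" by auto
  have "f2 0 * exp (- ((s + 1)\<^sup>2 / 2)) \<le> f2 (s + 1)" using f2_gauss_lower[of "s+1"] assms by simp
  also have "\<dots> \<le> f2 z" using f2_antimono[of z "s+1"] z assms by simp
  finally show ?thesis using z f1_le_1[of "s+1"] assms by simp
qed

text \<open>Beyond \<open>a\<close>, the function \<open>f'' / f(a) + f'\<close> decreases to a limit that is at least \<open>1\<close>.\<close>

lemma f1_deficit_upper:
  assumes "0 < a" "a \<le> s" shows "1 - f1 s \<le> f2 s / f a"
proof -
  have fa: "f a > 0" using f_pos assms by simp
  have *: "- (f2 s / f a + f1 s) \<le> - (f2 t / f a + f1 t)" if "s \<le> t" for t
  proof (rule half_line_mono[where a = a and h = "\<lambda>s. - (f2 s / f a + f1 s)" and h' = "\<lambda>s. (f s / f a - 1) * f2 s"])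
    show "0 \<le> (f r / f a - 1) * f2 r" if "a < r" for r
      using f_mono[of a r] f2_pos[of r] fa that assms by (simp add: field_simps)
  qed (use assms fa that in \<open>auto intro!: derivative_eq_intros continuous_intros f2_deriv f1_deriv simp: field_simps\<close>)
  have ev: "eventually (\<lambda>t. f1 t - f2 s / f a - f1 s \<le> 0) at_top"
    unfolding eventually_at_top_linorder
  proof (intro exI allI impI)
    fix t assume "s \<le> t"
    then show "f1 t - f2 s / f a - f1 s \<le> 0"
      using *[of t] f2_pos[of t] fa assms by (smt (verit) divide_nonneg_pos)
  qed
  have lim: "((\<lambda>t. f1 t - f2 s / f a - f1 s) \<longlongrightarrow> 1 - f2 s / f a - f1 s) at_top"
    by (intro tendsto_intros f1_limit)
  have "1 - f2 s / f a - f1 s \<le> 0"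
    by (rule tendsto_upperbound[OF lim ev]) simp
  then show ?thesis by simp
qed

text \<open>The von Mises variable \<open>\<psi> / sqrt (2 (x + A))\<close> of the Blasius flow at \<open>\<eta>\<close> is \<open>f \<eta>\<close>.\<close>

definition finv :: "real \<Rightarrow> real" where
  "finv = the_inv_into {0..} f"

lemma f_inj: "inj_on f {0..}"
proof (rule inj_onI)
  fix x y assume *: "x \<in> {0..}" "y \<in> {0..}" "f x = f y"
  then show "x = y" using f_strict_mono[of x y] f_strict_mono[of y x] by (cases x y rule: linorder_cases) auto
qed

lemma finv_f: "0 \<le> s \<Longrightarrow> finv (f s) = s"
  unfolding finv_def using the_inv_into_f_f[OF f_inj] by simp

lemma f_onto:
  assumes "0 \<le> \<sigma>" obtains s where "0 \<le> s" "f s = \<sigma>"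
proof -
  define t where "t = 1 + \<sigma> / f1 1"
  have t: "0 \<le> t" using f1_pos[of 1] assms by (simp add: t_def)
  have "\<sigma> \<le> f t" using f_tangent[OF t] f1_pos[of 1] by (simp add: t_def)
  moreover have "continuous_on {0..t} f" by (rule continuous_on_subset[OF f_cont]) auto
  ultimately have "\<exists>s. 0 \<le> s \<and> s \<le> t \<and> f s = \<sigma>" using IVT'[of f 0 \<sigma> t] assms t by auto
  then show ?thesis using that by blast
qed

lemma
  assumes "0 \<le> \<sigma>"
  shows f_finv: "f (finv \<sigma>) = \<sigma>" and finv_nonneg: "0 \<le> finv \<sigma>"
proof -
  from assms obtain s where "0 \<le> s" "f s = \<sigma>" by (rule f_onto)
  then show "f (finv \<sigma>) = \<sigma>" "0 \<le> finv \<sigma>" using finv_f[of s] by auto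
qed

lemma finv_0 [simp]: "finv 0 = 0"
  using finv_f[of 0] by simp

lemma finv_pos: "0 < \<sigma> \<Longrightarrow> 0 < finv \<sigma>"
  using f_finv[of \<sigma>] finv_nonneg[of \<sigma>] by (cases "finv \<sigma> = 0") auto

lemma finv_mono: "0 \<le> \<sigma> \<Longrightarrow> \<sigma> \<le> \<tau> \<Longrightarrow> finv \<sigma> \<le> finv \<tau>"
  using f_strict_mono[of "finv \<tau>" "finv \<sigma>"] f_finv[of \<sigma>] f_finv[of \<tau>] finv_nonneg[of \<tau>]
  by (cases "finv \<sigma> \<le> finv \<tau>") auto

lemma finv_cont: "continuous_on {0..} finv"
proof -
  have sub: "{0..f n} \<subseteq> f ` {0..n}" if "0 \<le> n" for n
  proof
    fix \<sigma> assume "\<sigma> \<in> {0..f n}"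
    then show "\<sigma> \<in> f ` {0..n}"
      using finv_mono[of \<sigma> "f n"] finv_f[OF that] f_finv[of \<sigma>] finv_nonneg[of \<sigma>]
      by (intro image_eqI[of _ _ "finv \<sigma>"]) auto
  qed
  have "continuous_on (f ` {0..n}) finv" if "0 \<le> n" for n
    by (rule continuous_on_inv) (auto simp: finv_f intro: continuous_on_subset[OF f_cont])
  then have c: "continuous_on {0..f n} finv" if "0 \<le> n" for n
    using continuous_on_subset sub[OF that] that by blast
  show ?thesis
    unfolding continuous_on_eq_continuous_within
  proof
    fix \<sigma> :: real assume "\<sigma> \<in> {0..}"
    then have s: "0 \<le> \<sigma>" by simp
    define n where "n = finv (\<sigma> + 1)"
    have n: "0 \<le> n" "f n = \<sigma> + 1" using s f_finv finv_nonneg by (auto simp: n_def)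
    have "continuous (at \<sigma> within {0..\<sigma>+1}) finv"
      using c[OF n(1)] s unfolding n(2) continuous_on_eq_continuous_within by simp
    moreover have "at \<sigma> within {0..\<sigma>+1} = at \<sigma> within {0..}"
      by (rule at_within_nhd[of _ "{..<\<sigma>+1}"]) (use s in auto)
    ultimately show "continuous (at \<sigma> within {0..}) finv" by metis
  qed
qed

lemma finv_deriv:
  assumes "0 < \<sigma>" shows "(finv has_real_derivative inverse (f1 (finv \<sigma>))) (at \<sigma>)"
proof (rule DERIV_inverse_function[where f = f and a = 0 and b = "\<sigma>+1"])
  show "DERIV f (finv \<sigma>) :> f1 (finv \<sigma>)" by (rule f_deriv[OF finv_pos[OF assms]])
  show "f1 (finv \<sigma>) \<noteq> 0" using f1_pos[OF finv_pos[OF assms]] by simp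
  have "\<sigma> \<in> interior {0::real..}" using assms by (simp add: interior_real_atLeast)
  then show "isCont finv \<sigma>" by (rule continuous_on_interior[OF finv_cont])
qed (use assms f_finv in auto)

end

section \<open>The flow in von Mises variables\<close>

locale oleinik_flow =
  fixes u0 :: "real \<Rightarrow> real" and u v :: "real \<Rightarrow> real \<Rightarrow> real"
  assumes datum: "oleinik_datum u0"
    and solution: "oleinik_solution u0 u v"
begin

lemma system: "prandtl_system u0 u v"
  using solution unfolding oleinik_solution_def by (rule conjunct1)

lemma u_wall: "0 \<le> x \<Longrightarrow> u x 0 = 0" and v_wall: "0 \<le> x \<Longrightarrow> v x 0 = 0"
  and u_initial: "0 \<le> y \<Longrightarrow> u 0 y = u0 y"
  using system unfolding prandtl_system_def by blast+

lemma
  assumes "0 < x" "0 < y"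
  shows momentum: "u x y * Dx u x y + v x y * Dy u x y = Dy (Dy u) x y"
    and incompressible: "Dx u x y = - Dy v x y"
proof -
  have "u x y * Dx u x y + v x y * Dy u x y - Dy (Dy u) x y = 0" "Dx u x y + Dy v x y = 0"
    using system assms unfolding prandtl_system_def by blast+
  then show "u x y * Dx u x y + v x y * Dy u x y = Dy (Dy u) x y" "Dx u x y = - Dy v x y" by linarith+
qed

lemma u_limit:
  assumes "0 \<le> x" shows "(u x \<longlongrightarrow> 1) at_top"
proof (cases "x = 0")
  case True
  have "eventually (\<lambda>y. u0 y = u 0 y) at_top"
    by (rule eventually_at_top_linorderI[of 0]) (simp add: u_initial)
  then show ?thesis
    using datum True unfolding oleinik_datum_def by (metis Lim_transform_eventually)
next
  case False
  then show ?thesis using system assms unfolding prandtl_system_def by simp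
qed

lemma u_pos: "0 \<le> x \<Longrightarrow> 0 < y \<Longrightarrow> 0 < u x y"
proof -
  assume *: "0 \<le> x" "0 < y"
  have "\<forall>X>0. \<forall>x\<in>{0..X}. \<forall>y>0. u x y > 0" using solution unfolding oleinik_solution_def by blast
  from this[rule_format, of "x+1" x y] * show ?thesis by simp
qed

lemma u_nonneg: "0 \<le> x \<Longrightarrow> 0 \<le> y \<Longrightarrow> 0 \<le> u x y"
  using u_pos[of x y] u_wall[of x] by (cases "y = 0") auto

lemma u_cont: "0 < X \<Longrightarrow> continuous_on ({0..X} \<times> {0..}) (\<lambda>(x, y). u x y)"
  and ux_cont: "0 < X \<Longrightarrow> continuous_on ({0..X} \<times> {0..}) (\<lambda>(x, y). Dx u x y)"
  using solution unfolding oleinik_solution_def by blast+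

lemma u_bounded:
  assumes "0 < X"
  obtains M where "1 \<le> M" "\<And>x y. 0 \<le> x \<Longrightarrow> x \<le> X \<Longrightarrow> 0 \<le> y \<Longrightarrow> u x y \<le> M"
proof -
  have "bounded ((\<lambda>(x, y). u x y) ` ({0..X} \<times> {0..}))"
    using solution assms unfolding oleinik_solution_def by blast
  then obtain M where M: "\<And>z. z \<in> (\<lambda>(x, y). u x y) ` ({0..X} \<times> {0..}) \<Longrightarrow> norm z \<le> M"
    unfolding bounded_iff by blast
  show ?thesis
  proof (rule that[of "max 1 M"])
    show "u x y \<le> max 1 M" if "0 \<le> x" "x \<le> X" "0 \<le> y" for x y
    proof -
      have "norm (u x y) \<le> M" by (rule M) (use that in force)
      then show ?thesis by simp
    qed
  qed simp
qed

lemma u_lipschitz_initial: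
  obtains L where "0 < L" "\<And>y. 0 \<le> y \<Longrightarrow> u 0 y \<le> L * y"
proof -
  have "bounded ((\<lambda>(x, y). Dy u x y) ` ({0..1} \<times> {0..}))"
    using solution unfolding oleinik_solution_def by (metis insertCI zero_less_one)
  then obtain M where M: "\<And>z. z \<in> (\<lambda>(x, y). Dy u x y) ` ({0..1} \<times> {0..}) \<Longrightarrow> norm z \<le> M"
    unfolding bounded_iff by blast
  have diff: "u 0 differentiable_on {0..}" using solution unfolding oleinik_solution_def by blast
  show ?thesis
  proof (rule that[of "max 1 M"])
    show "u 0 y \<le> max 1 M * y" if "0 \<le> y" for y
    proof (rule half_line_compare[where g = "u 0" and k = "\<lambda>y. max 1 M * y" and g' = "Dy u 0" and k' = "\<lambda>_. max 1 M"])
      show "continuous_on {0..} (u 0)" by (rule differentiable_imp_continuous_on[OF diff])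
      show "(u 0 has_real_derivative Dy u 0 s) (at s)" if "0 < s" for s
        using half_deriv_at[OF diff that] by (simp add: Dy_def)
      show "Dy u 0 s \<le> max 1 M" if "0 < s" for s
      proof -
        have "norm (Dy u 0 s) \<le> M" by (rule M) (use that in force)
        then show ?thesis by simp
      qed
    qed (use that u_wall in \<open>auto intro!: derivative_eq_intros continuous_intros\<close>)
  qed simp
qed

lemma
  assumes "0 \<le> x"
  shows u_cont_y: "continuous_on {0..} (u x)"
    and u_deriv_y: "0 < y \<Longrightarrow> (u x has_real_derivative Dy u x y) (at y)"
    and uy_deriv_y: "0 < y \<Longrightarrow> (Dy u x has_real_derivative Dy (Dy u) x y) (at y)"
    and v_cont_y: "continuous_on {0..} (v x)"
    and v_deriv_y: "0 < y \<Longrightarrow> (v x has_real_derivative Dy v x y) (at y)"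
proof -
  have d: "u x differentiable_on {0..}" "Dy u x differentiable_on {0..}" "v x differentiable_on {0..}"
    using solution assms unfolding oleinik_solution_def by blast+
  show "continuous_on {0..} (u x)" "continuous_on {0..} (v x)"
    using d by (auto intro: differentiable_imp_continuous_on)
  show "(u x has_real_derivative Dy u x y) (at y)" if "0 < y"
    using half_deriv_at[OF d(1) that] by (simp add: Dy_def)
  show "(Dy u x has_real_derivative Dy (Dy u) x y) (at y)" if "0 < y"
    using half_deriv_at[OF d(2) that] unfolding Dy_def[of "Dy u"] .
  show "(v x has_real_derivative Dy v x y) (at y)" if "0 < y"
    using half_deriv_at[OF d(3) that] by (simp add: Dy_def)
qed

lemma
  assumes "0 \<le> y"
  shows u_deriv_x_within: "0 \<le> x \<Longrightarrow> ((\<lambda>x. u x y) has_real_derivative Dx u x y) (at x within {0..})"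
    and u_deriv_x: "0 < x \<Longrightarrow> ((\<lambda>x. u x y) has_real_derivative Dx u x y) (at x)"
proof -
  have d: "(\<lambda>x. u x y) differentiable_on {0..}"
    using solution assms unfolding oleinik_solution_def by blast
  show "((\<lambda>x. u x y) has_real_derivative Dx u x y) (at x within {0..})" if "0 \<le> x"
    using half_deriv_within[OF d that] unfolding Dx_def .
  show "((\<lambda>x. u x y) has_real_derivative Dx u x y) (at x)" if "0 < x"
    using half_deriv_at[OF d that] unfolding Dx_def .
qed

definition psi :: "real \<Rightarrow> real \<Rightarrow> real" where
  "psi x y = integral {0..y} (u x)"

lemma psi_0 [simp]: "psi x 0 = 0"
  by (simp add: psi_def)

lemma psi_within:
  assumes "0 \<le> x" "0 \<le> y" "y < Y"
  shows "(psi x has_real_derivative u x y) (at y within {0..Y})"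
proof -
  have "continuous_on {0..Y} (u x)" by (rule continuous_on_subset[OF u_cont_y]) (use assms in auto)
  then show ?thesis unfolding psi_def by (rule integral_has_real_derivative) (use assms in auto)
qed

lemma psi_deriv_y:
  assumes "0 \<le> x" "0 < y" shows "(psi x has_real_derivative u x y) (at y)"
proof -
  have "y \<in> interior {0..y+1}" using assms by (simp add: interior_atLeastAtMost_real)
  then show ?thesis using psi_within[of x y "y+1"] assms at_within_interior by fastforce
qed

lemma psi_cont_y:
  assumes "0 \<le> x" shows "continuous_on {0..} (psi x)"
  unfolding continuous_on_eq_continuous_within
proof
  fix y :: real assume "y \<in> {0..}"
  then have y: "0 \<le> y" by simp
  have "continuous (at y within {0..y+1}) (psi x)"
    by (rule DERIV_continuous[OF psi_within]) (use assms y in auto)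
  moreover have "at y within {0..y+1} = at y within {0..}"
    by (rule at_within_nhd[of _ "{..<y+1}"]) (use y in auto)
  ultimately show "continuous (at y within {0..}) (psi x)" by metis
qed

lemma psi_mono: "0 \<le> x \<Longrightarrow> 0 \<le> y \<Longrightarrow> y \<le> z \<Longrightarrow> psi x y \<le> psi x z"
  by (rule half_line_mono[where a = 0 and h = "psi x" and h' = "u x"])
    (auto intro: psi_cont_y psi_deriv_y less_imp_le[OF u_pos])

lemma psi_nonneg: "0 \<le> x \<Longrightarrow> 0 \<le> y \<Longrightarrow> 0 \<le> psi x y"
  using psi_mono[of x 0 y] by simp

lemma psi_pos:
  assumes "0 \<le> x" "0 < y" shows "0 < psi x y"
proof -
  have "psi x 0 < psi x y"
  proof (rule DERIV_pos_imp_increasing_open[OF assms(2)])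
    show "\<exists>d. DERIV (psi x) z :> d \<and> 0 < d" if "0 < z" "z < y" for z
      using that assms psi_deriv_y[of x z] u_pos[of x z] by auto
    show "continuous_on {0..y} (psi x)" by (rule continuous_on_subset[OF psi_cont_y]) (use assms in auto)
  qed
  then show ?thesis by simp
qed

lemma psi_deriv_x:
  assumes x: "0 < x" and y: "0 < y"
  shows "((\<lambda>x. psi x y) has_real_derivative - v x y) (at x)"
proof -
  let ?U = "{0..x+1}"
  have "((\<lambda>x. integral (cbox 0 y) (u x)) has_field_derivative integral (cbox 0 y) (Dx u x)) (at x within ?U)"
  proof (rule leibniz_rule_field_derivative)
    show "((\<lambda>x. u x t) has_field_derivative Dx u z t) (at z within ?U)" if "z \<in> ?U" "t \<in> cbox 0 y" for z t
      by (rule DERIV_subset[OF u_deriv_x_within]) (use that in auto)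
    show "u z integrable_on cbox 0 y" if "z \<in> ?U" for z
      by (rule integrable_continuous, rule continuous_on_subset[OF u_cont_y]) (use that in auto)
    show "continuous_on (?U \<times> cbox 0 y) (\<lambda>(x, t). Dx u x t)"
      by (rule continuous_on_subset[OF ux_cont[of "x+1"]]) (use x in auto)
  qed (use x in auto)
  moreover have "x \<in> interior ?U" using x by (simp add: interior_atLeastAtMost_real)
  ultimately have "((\<lambda>x. integral {0..y} (u x)) has_real_derivative integral {0..y} (Dx u x)) (at x)"
    using at_within_interior by fastforce
  moreover have "integral {0..y} (Dx u x) = - v x y"
  proof (rule integral_unique)
    have "(Dx u x has_integral ((- v x y) - (- v x 0))) {0..y}"
    proof (rule fundamental_theorem_of_calculus_interior[of 0 y "\<lambda>y. - v x y"])
      show "continuous_on {0..y} (\<lambda>y. - v x y)"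
        by (intro continuous_on_minus, rule continuous_on_subset[OF v_cont_y]) (use x in auto)
      show "((\<lambda>y. - v x y) has_vector_derivative Dx u x t) (at t)" if "t \<in> {0<..<y}" for t
        unfolding has_real_derivative_iff_has_vector_derivative[symmetric]
        using that x incompressible[of x t] by (auto intro!: derivative_eq_intros v_deriv_y)
    qed (use y in simp)
    then show "(Dx u x has_integral - v x y) {0..y}" using v_wall[of x] x by simp
  qed
  ultimately show ?thesis by (simp add: psi_def)
qed

text \<open>On a fixed interval of integration, joint continuity passes from \<open>u\<close> to the integral.\<close>

lemma psi_scaled:
  assumes "0 \<le> x" "0 \<le> y" shows "psi x y = y * integral {0..1} (\<lambda>t. u x (t * y))"
proof (cases "y = 0")
  case False
  then have y: "0 < y" using assms by simp
  have "continuous_on {0..y} (u x)" by (rule continuous_on_subset[OF u_cont_y]) (use assms in auto)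
  then have "(u x has_integral psi x y) (cbox 0 y)"
    unfolding psi_def using integrable_continuous_real integrable_integral by fastforce
  from has_integral_affinity[OF this, of y 0] y
  have "((\<lambda>t. u x (y * t)) has_integral psi x y / y) ((\<lambda>t. inverse y * t) ` {0..y})"
    by (simp add: divide_inverse mult.commute)
  moreover have "(\<lambda>t. inverse y * t) ` {0..y} = {0..1}"
    using y image_mult_atLeastAtMost[of "inverse y" 0 y] by simp
  ultimately show ?thesis
    using y by (auto dest!: integral_unique simp: mult.commute)
qed simp

lemma psi_cont:
  assumes "0 < X" shows "continuous_on ({0..X} \<times> {0..}) (\<lambda>(x, y). psi x y)"
proof -
  let ?S = "{0..X} \<times> {0::real..}"
  have "continuous_on (?S \<times> cbox 0 1) (\<lambda>w. (\<lambda>(x, y). u x y) (fst (fst w), snd w * snd (fst w)))"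
    by (rule continuous_on_compose2[OF u_cont[OF assms]]) (auto intro!: continuous_intros)
  then have "continuous_on (?S \<times> cbox 0 1) (\<lambda>(z, t). u (fst z) (t * snd z))"
    by (simp add: case_prod_unfold)
  then have "continuous_on ?S (\<lambda>z. integral (cbox 0 1) (\<lambda>t. u (fst z) (t * snd z)))"
    by (rule integral_continuous_on_param)
  then have "continuous_on ?S (\<lambda>z. snd z * integral (cbox 0 1) (\<lambda>t. u (fst z) (t * snd z)))"
    by (intro continuous_intros)
  then show ?thesis
    by (rule continuous_on_cong[THEN iffD1, rotated 2]) (auto simp: psi_scaled)
qed

lemma psi_unbounded:
  assumes "0 \<le> x" obtains Y where "0 \<le> Y" "K < psi x Y"
proof -
  have "eventually (\<lambda>y. 1/2 < u x y) at_top"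
    using u_limit[OF assms] by (rule order_tendstoD) simp
  then obtain Z where half: "\<And>y. y \<ge> Z \<Longrightarrow> 1/2 < u x y" unfolding eventually_at_top_linorder by blast
  have Z: "1 \<le> u x y * 2" if "Z < y" for y using half[of y] that by simp
  define a where "a = max Z 0"
  define Y where "Y = a + 2 * (\<bar>K\<bar> + 1)"
  have a: "0 \<le> a" "a \<le> Y" by (auto simp: a_def Y_def)
  have "psi x a - a/2 \<le> psi x Y - Y/2"
    by (rule half_line_mono[where a = a and h = "\<lambda>y. psi x y - y/2" and h' = "\<lambda>y. u x y - 1/2"])
      (use a assms in \<open>auto intro!: derivative_eq_intros continuous_intros psi_deriv_y
        continuous_on_subset[OF psi_cont_y] dest: Z simp: a_def\<close>)
  moreover have "Y/2 = a/2 + (\<bar>K\<bar> + 1)" by (simp add: Y_def field_simps)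
  ultimately have "K < psi x Y" using psi_nonneg[OF assms a(1)] abs_ge_self[of K] by linarith
  then show ?thesis using that[of Y] a by auto
qed

text \<open>Dini's argument: the divergence is pointwise in \<open>x\<close>, and \<open>psi\<close> is monotone in \<open>y\<close>.\<close>

lemma psi_grows:
  assumes "0 < X" shows "\<exists>Y. \<forall>x\<in>{0..X}. \<forall>y\<ge>Y. K \<le> psi x y"
proof (rule ccontr)
  assume "\<not> ?thesis"
  then have neg: "\<exists>x\<in>{0..X}. \<exists>y\<ge>Y. psi x y < K" for Y by (auto simp: not_le)
  have "\<exists>x\<in>{0..X}. psi x (real n) < K" for n
  proof -
    obtain x y where "x \<in> {0..X}" "y \<ge> real n" "psi x y < K" using neg[of "real n"] by blast
    then show ?thesis using psi_mono[of x "real n" y] by force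
  qed
  then obtain s where s: "\<And>n. s n \<in> {0..X}" "\<And>n. psi (s n) (real n) < K" by metis
  have "compact {0..X}" by (rule compact_Icc)
  then obtain l r where l: "l \<in> {0..X}" "strict_mono (r :: nat \<Rightarrow> nat)" "(s \<circ> r) \<longlonglongrightarrow> l"
    using s(1) unfolding compact_def by metis
  obtain Y where Y: "0 \<le> Y" "K < psi l Y" using psi_unbounded[of l K] l(1) by auto
  have "continuous_on {0..X} (\<lambda>x. (\<lambda>(x, y). psi x y) (x, Y))"
    by (rule continuous_on_compose2[OF psi_cont[OF assms]]) (use Y in \<open>auto intro!: continuous_intros\<close>)
  then have "(\<lambda>n. psi ((s \<circ> r) n) Y) \<longlonglongrightarrow> psi l Y"
    using l s(1) by (auto simp: continuous_on_sequentially o_def)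
  then have "eventually (\<lambda>n. K < psi ((s \<circ> r) n) Y) sequentially" using Y(2) by (rule order_tendstoD)
  moreover have "eventually (\<lambda>n. Y \<le> real n) sequentially"
    using filterlim_real_sequentially by (auto simp: filterlim_at_top)
  ultimately have "eventually (\<lambda>n. K < psi ((s \<circ> r) n) Y \<and> Y \<le> real n) sequentially"
    by (rule eventually_conj)
  then obtain n where n: "K < psi (s (r n)) Y" "Y \<le> real n" by (auto simp: eventually_sequentially)
  have "real n \<le> real (r n)" using seq_suble[OF l(2)] by simp
  then have "psi (s (r n)) Y \<le> psi (s (r n)) (real (r n))"
    using n s(1)[of "r n"] Y by (intro psi_mono) auto
  then show False using n(1) s(2)[of "r n"] by simp
qed

text \<open>
  In von Mises variables \<open>(x, \<psi>)\<close> the equation reads \<open>w\<^sub>x = u w\<^sub>\<psi>\<^sub>\<psi>\<close> for \<open>w = u\<^sup>2\<close>. Pulled back to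
  \<open>(x, y)\<close>, the operator \<open>u (\<partial>\<^sub>x - u \<partial>\<^sub>\<psi>\<^sub>\<psi>)\<close> becomes \<open>u \<partial>\<^sub>x + (v + u\<^sub>y / u) \<partial>\<^sub>y - \<partial>\<^sub>y\<^sub>y\<close>; so \<open>w\<close> is
  compared with barriers through a linear operator, and the inverse of \<open>y \<mapsto> \<psi>\<close> never appears.
  The sign \<open>s\<close> covers upper and lower barriers at once.
\<close>

definition drift :: "real \<Rightarrow> real \<Rightarrow> real" where
  "drift x y = v x y + Dy u x y / u x y"

lemma von_mises_equation:
  assumes "0 < x" "0 < y"
  shows "u x y * (2 * u x y * Dx u x y) + drift x y * (2 * u x y * Dy u x y)
    - (2 * (Dy u x y)\<^sup>2 + 2 * u x y * Dy (Dy u) x y) = 0"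
  using u_pos[of x y] assms unfolding momentum[OF assms, symmetric] drift_def
  by (simp add: field_simps power2_eq_square)

lemma barrier_comparison:
  fixes \<beta> \<beta>x \<beta>y \<beta>yy :: "real \<Rightarrow> real \<Rightarrow> real"
  assumes X: "0 < X" and s: "\<bar>s\<bar> = 1"
    and cont: "continuous_on ({0..X} \<times> {0..}) (\<lambda>(x, y). \<beta> x y)"
    and bd: "\<And>x y. 0 \<le> x \<Longrightarrow> x \<le> X \<Longrightarrow> 0 \<le> y \<Longrightarrow> \<bar>\<beta> x y\<bar> \<le> K"
    and \<beta>x: "\<And>x y. 0 < x \<Longrightarrow> x \<le> X \<Longrightarrow> 0 < y \<Longrightarrow> ((\<lambda>x. \<beta> x y) has_real_derivative \<beta>x x y) (at x)"
    and \<beta>y: "\<And>x y. 0 < x \<Longrightarrow> x \<le> X \<Longrightarrow> 0 < y \<Longrightarrow> (\<beta> x has_real_derivative \<beta>y x y) (at y)"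
    and \<beta>yy: "\<And>x y. 0 < x \<Longrightarrow> x \<le> X \<Longrightarrow> 0 < y \<Longrightarrow> (\<beta>y x has_real_derivative \<beta>yy x y) (at y)"
    and barrier: "\<And>x y. 0 < x \<Longrightarrow> x \<le> X \<Longrightarrow> 0 < y \<Longrightarrow> 0 < s * ((u x y)\<^sup>2 - \<beta> x y) \<Longrightarrow>
        0 \<le> s * (u x y * \<beta>x x y + drift x y * \<beta>y x y - \<beta>yy x y)"
    and initial: "\<And>y. 0 \<le> y \<Longrightarrow> s * ((u 0 y)\<^sup>2 - \<beta> 0 y) \<le> 0"
    and wall: "\<And>x. 0 \<le> x \<Longrightarrow> x \<le> X \<Longrightarrow> s * \<beta> x 0 \<ge> 0"
    and xy: "0 \<le> x" "x \<le> X" "0 \<le> y"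
  shows "s * ((u x y)\<^sup>2 - \<beta> x y) \<le> 0"
proof -
  obtain M where M: "1 \<le> M" "\<And>x y. 0 \<le> x \<Longrightarrow> x \<le> X \<Longrightarrow> 0 \<le> y \<Longrightarrow> u x y \<le> M"
    using u_bounded[OF X] by blast
  (* the pulled-back operator maps E to u * (2 * M + 1 - 2 * u) > 0 *)
  define E where "E x y = 1 + (psi x y)\<^sup>2 + (2 * M + 1) * x" for x y
  have dpsi: "((\<lambda>x. psi x y) has_real_derivative - v x y) (at x)"
    "(psi x has_real_derivative u x y) (at y)" if "0 < x" "0 < y" for x y
    using that psi_deriv_x psi_deriv_y by auto
  have E_ge: "1 + (psi x y)\<^sup>2 \<le> E x y" if "0 \<le> x" for x y using that M by (simp add: E_def)
  show ?thesis
  proof (rule parabolic_maximum_principle[where X = X and p = "\<lambda>x y. s * ((u x y)\<^sup>2 - \<beta> x y)"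
      and px = "\<lambda>x y. s * (2 * u x y * Dx u x y - \<beta>x x y)"
      and py = "\<lambda>x y. s * (2 * u x y * Dy u x y - \<beta>y x y)"
      and pyy = "\<lambda>x y. s * (2 * (Dy u x y)\<^sup>2 + 2 * u x y * Dy (Dy u) x y - \<beta>yy x y)"
      and E = E and Ex = "\<lambda>x y. 2 * psi x y * (- v x y) + (2 * M + 1)"
      and Ey = "\<lambda>x y. 2 * psi x y * u x y"
      and Eyy = "\<lambda>x y. 2 * (u x y)\<^sup>2 + 2 * psi x y * Dy u x y"
      and u = u and b = drift and K = "M\<^sup>2 + K"])
    show "continuous_on ({0..X} \<times> {0..}) (\<lambda>(x, y). s * ((u x y)\<^sup>2 - \<beta> x y))"
      using cont u_cont[OF X] by (auto simp: case_prod_unfold intro!: continuous_intros)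
    show "continuous_on ({0..X} \<times> {0..}) (\<lambda>(x, y). E x y)"
      using psi_cont[OF X] by (auto simp: case_prod_unfold E_def intro!: continuous_intros)
    show "\<exists>Y. \<forall>x\<in>{0..X}. \<forall>y\<ge>Y. k \<le> E x y" for k
    proof -
      obtain Y where Y: "\<And>x y. x \<in> {0..X} \<Longrightarrow> y \<ge> Y \<Longrightarrow> max k 1 \<le> psi x y"
        using psi_grows[OF X, of "max k 1"] by blast
      have "k \<le> E x y" if "x \<in> {0..X}" "y \<ge> Y" for x y
      proof -
        have ge: "max k 1 \<le> psi x y" using Y that by simp
        then have "psi x y * 1 \<le> psi x y * psi x y" by (intro mult_left_mono) auto
        moreover have "1 + psi x y * psi x y \<le> E x y"
          using E_ge[of x y] that by (simp add: power2_eq_square)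
        ultimately show ?thesis using ge by linarith
      qed
      then show ?thesis by blast
    qed
    show "s * ((u x y)\<^sup>2 - \<beta> x y) \<le> M\<^sup>2 + K" if "0 \<le> x" "x \<le> X" "0 \<le> y" for x y
    proof -
      have "s * ((u x y)\<^sup>2 - \<beta> x y) \<le> \<bar>s * ((u x y)\<^sup>2 - \<beta> x y)\<bar>" by simp
      also have "\<dots> \<le> (u x y)\<^sup>2 + \<bar>\<beta> x y\<bar>"
        using s abs_triangle_ineq4[of "(u x y)\<^sup>2" "\<beta> x y"] by (simp add: abs_mult)
      also have "(u x y)\<^sup>2 \<le> M\<^sup>2" using M(2) u_nonneg that by (intro power_mono) auto
      finally show ?thesis using bd[OF that] by simp
    qed
    show "0 < u x y * (2 * psi x y * (- v x y) + (2 * M + 1)) + drift x y * (2 * psi x y * u x y)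
        - (2 * (u x y)\<^sup>2 + 2 * psi x y * Dy u x y)" if "0 < x" "x \<le> X" "0 < y" for x y
    proof -
      have u: "0 < u x y" using u_pos that by simp
      have "u x y * (2 * psi x y * (- v x y) + (2 * M + 1)) + drift x y * (2 * psi x y * u x y)
        - (2 * (u x y)\<^sup>2 + 2 * psi x y * Dy u x y) = u x y * (1 + 2 * (M - u x y))"
        using u by (simp add: drift_def field_simps power2_eq_square)
      then show ?thesis using u M(2)[of x y] that by simp
    qed
    show "u x y * (s * (2 * u x y * Dx u x y - \<beta>x x y)) + drift x y * (s * (2 * u x y * Dy u x y - \<beta>y x y))
        - s * (2 * (Dy u x y)\<^sup>2 + 2 * u x y * Dy (Dy u) x y - \<beta>yy x y) \<le> 0"
      if "0 < x" "x \<le> X" "0 < y" "0 < s * ((u x y)\<^sup>2 - \<beta> x y)" for x y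
    proof -
      have "u x y * (s * (2 * u x y * Dx u x y - \<beta>x x y)) + drift x y * (s * (2 * u x y * Dy u x y - \<beta>y x y))
        - s * (2 * (Dy u x y)\<^sup>2 + 2 * u x y * Dy (Dy u) x y - \<beta>yy x y)
        = s * (u x y * (2 * u x y * Dx u x y) + drift x y * (2 * u x y * Dy u x y)
            - (2 * (Dy u x y)\<^sup>2 + 2 * u x y * Dy (Dy u) x y))
          - s * (u x y * \<beta>x x y + drift x y * \<beta>y x y - \<beta>yy x y)"
        by (simp add: algebra_simps)
      then show ?thesis using von_mises_equation[of x y] barrier[of x y] that by simp
    qed
    show "((\<lambda>x. s * ((u x y)\<^sup>2 - \<beta> x y)) has_real_derivative s * (2 * u x y * Dx u x y - \<beta>x x y)) (at x)"
      "((\<lambda>y. s * ((u x y)\<^sup>2 - \<beta> x y)) has_real_derivative s * (2 * u x y * Dy u x y - \<beta>y x y)) (at y)"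
      "((\<lambda>y. s * (2 * u x y * Dy u x y - \<beta>y x y)) has_real_derivative
          s * (2 * (Dy u x y)\<^sup>2 + 2 * u x y * Dy (Dy u) x y - \<beta>yy x y)) (at y)"
      "((\<lambda>x. E x y) has_real_derivative 2 * psi x y * (- v x y) + (2 * M + 1)) (at x)"
      "(E x has_real_derivative 2 * psi x y * u x y) (at y)"
      "((\<lambda>y. 2 * psi x y * u x y) has_real_derivative 2 * (u x y)\<^sup>2 + 2 * psi x y * Dy u x y) (at y)"
      if "0 < x" "x \<le> X" "0 < y" for x y
      using that unfolding E_def
      by (auto intro!: derivative_eq_intros u_deriv_x u_deriv_y uy_deriv_y \<beta>x \<beta>y \<beta>yy dpsi
          simp: power2_eq_square algebra_simps)
    show "0 \<le> u x y" if "0 < x" "0 < y" for x y using u_nonneg that by simp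
    show "0 \<le> E x y" if "0 \<le> x" for x y using E_ge[OF that, of y] by (smt (verit) zero_le_power2)
    show "s * ((u x 0)\<^sup>2 - \<beta> x 0) \<le> 0" if "0 \<le> x" "x \<le> X" for x
      using wall[OF that] u_wall[of x] that by simp
  qed (use initial xy in auto)
qed

end

section \<open>Barriers in the similarity variable\<close>

locale blasius_comparison = blasius f + oleinik_flow u0 u v
  for f u0 :: "real \<Rightarrow> real" and u v :: "real \<Rightarrow> real \<Rightarrow> real"
begin

text \<open>
  \<open>eta A x y\<close> is the similarity coordinate of the point of the Blasius flow of origin \<open>x = - A\<close> that
  lies on the same streamline as \<open>(x, y)\<close>; that flow has the velocity \<open>f' (eta A x y)\<close> there.
\<close>

definition eta :: "real \<Rightarrow> real \<Rightarrow> real \<Rightarrow> real" where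
  "eta A x y = finv (psi x y / sqrt (2 * (x + A)))"

lemma eta_0 [simp]: "eta A x 0 = 0"
  by (simp add: eta_def)

context
  fixes A :: real
  assumes A: "0 < A"
begin

lemma eta_nonneg: "0 \<le> x \<Longrightarrow> 0 \<le> y \<Longrightarrow> 0 \<le> eta A x y"
  using A psi_nonneg[of x y] by (simp add: eta_def finv_nonneg)

lemma eta_pos: "0 \<le> x \<Longrightarrow> 0 < y \<Longrightarrow> 0 < eta A x y"
  using A psi_pos[of x y] by (simp add: eta_def finv_pos)

lemma f_eta: "0 \<le> x \<Longrightarrow> 0 \<le> y \<Longrightarrow> f (eta A x y) = psi x y / sqrt (2 * (x + A))"
  using A psi_nonneg[of x y] by (simp add: eta_def f_finv)

lemma eta_cont:
  assumes "0 < X" shows "continuous_on ({0..X} \<times> {0..}) (\<lambda>(x, y). eta A x y)"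
proof -
  have "continuous_on ({0..X} \<times> {0..}) (\<lambda>z. psi (fst z) (snd z) / sqrt (2 * (fst z + A)))"
    using psi_cont[OF assms] A by (auto simp: case_prod_unfold intro!: continuous_intros)
  then have "continuous_on ({0..X} \<times> {0..}) (\<lambda>z. finv (psi (fst z) (snd z) / sqrt (2 * (fst z + A))))"
    by (rule continuous_on_compose2[OF finv_cont]) (use A in \<open>auto intro!: divide_nonneg_nonneg psi_nonneg\<close>)
  then show ?thesis by (simp add: eta_def case_prod_unfold)
qed

lemma eta_deriv_y:
  assumes "0 \<le> x" "0 < y"
  shows "(eta A x has_real_derivative u x y / (sqrt (2 * (x + A)) * f1 (eta A x y))) (at y)"
proof -
  have "(eta A x has_real_derivative inverse (f1 (eta A x y)) * (u x y / sqrt (2 * (x + A)))) (at y)"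
    unfolding eta_def
    by (rule DERIV_chain'[OF DERIV_cdivide[OF psi_deriv_y[OF assms]] finv_deriv])
      (use A assms psi_pos in simp)
  then show ?thesis by (simp add: divide_inverse mult_ac)
qed

lemma eta_deriv_x:
  assumes "0 < x" "0 < y"
  shows "((\<lambda>x. eta A x y) has_real_derivative
    (- v x y / sqrt (2 * (x + A)) - f (eta A x y) / (2 * (x + A))) / f1 (eta A x y)) (at x)"
proof -
  let ?S = "sqrt (2 * (x + A))"
  have S: "0 < ?S" "?S * ?S = 2 * (x + A)" using A assms by auto
  have "((\<lambda>x. psi x y / sqrt (2 * (x + A))) has_real_derivative
      (- v x y * ?S - psi x y * (1 / ?S)) / (?S * ?S)) (at x)"
  proof (rule DERIV_divide[OF psi_deriv_x[OF assms]])
    show "((\<lambda>x. sqrt (2 * (x + A))) has_real_derivative 1 / ?S) (at x)"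
      using A assms by (auto intro!: derivative_eq_intros simp: field_simps)
  qed (use S in simp)
  also have "(- v x y * ?S - psi x y * (1 / ?S)) / (?S * ?S)
      = - v x y / ?S - f (eta A x y) / (2 * (x + A))"
  proof -
    define R where "R = ?S"
    have R: "0 < R" "2 * (x + A) = R * R" "f (eta A x y) = psi x y / R"
      using S f_eta[of x y] assms by (auto simp: R_def)
    show ?thesis unfolding R_def[symmetric] R(2,3) using R(1) by (simp add: field_simps)
  qed
  finally have d: "((\<lambda>x. psi x y / sqrt (2 * (x + A))) has_real_derivative
      - v x y / ?S - f (eta A x y) / (2 * (x + A))) (at x)" .
  have "((\<lambda>x. eta A x y) has_real_derivative
      inverse (f1 (eta A x y)) * (- v x y / ?S - f (eta A x y) / (2 * (x + A)))) (at x)"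
    unfolding eta_def
    by (rule DERIV_chain'[OF d[unfolded eta_def] finv_deriv]) (use A assms psi_pos in simp)
  then show ?thesis by (simp add: divide_inverse mult_ac)
qed

text \<open>
  The barrier condition below is \<open>2 (x + A) f'\<close> times \<open>\<beta>\<^sub>x - u \<beta>\<^sub>\<psi>\<^sub>\<psi> \<ge> 0\<close>, written in the coordinates
  \<open>(x, \<eta>)\<close>; the ratio \<open>u / f'(\<eta>)\<close> to the Blasius velocity on the same streamline is all that is
  left of the unknown flow.
\<close>

lemma similarity_comparison:
  fixes P P' P'' Q Q' Q'' \<theta> \<theta>' :: "real \<Rightarrow> real"
  assumes s: "\<bar>s\<bar> = 1"
    and Pc: "continuous_on {0..} P" and Qc: "continuous_on {0..} Q"
    and Pb: "\<And>t. 0 \<le> t \<Longrightarrow> \<bar>P t\<bar> \<le> K" and Qb: "\<And>t. 0 \<le> t \<Longrightarrow> \<bar>Q t\<bar> \<le> K"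
    and P: "\<And>t. 0 < t \<Longrightarrow> (P has_real_derivative P' t) (at t)"
    and P': "\<And>t. 0 < t \<Longrightarrow> (P' has_real_derivative P'' t) (at t)"
    and Q: "\<And>t. 0 < t \<Longrightarrow> (Q has_real_derivative Q' t) (at t)"
    and Q': "\<And>t. 0 < t \<Longrightarrow> (Q' has_real_derivative Q'' t) (at t)"
    and \<theta>: "\<And>x. 0 \<le> x \<Longrightarrow> (\<theta> has_real_derivative \<theta>' x) (at x)"
    and barrier: "\<And>x y t r. 0 < x \<Longrightarrow> 0 < y \<Longrightarrow> t = eta A x y \<Longrightarrow> 0 < t \<Longrightarrow> r = u x y / f1 t \<Longrightarrow> 0 < r \<Longrightarrow>
        0 < s * (r\<^sup>2 * (f1 t)\<^sup>2 - (P t + \<theta> x * Q t)) \<Longrightarrow>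
        0 \<le> s * (2 * (x + A) * f1 t * \<theta>' x * Q t - f t * (P' t + \<theta> x * Q' t)
          - r * (P'' t + \<theta> x * Q'' t - f2 t / f1 t * (P' t + \<theta> x * Q' t)))"
    and initial: "\<And>y. 0 \<le> y \<Longrightarrow> s * ((u 0 y)\<^sup>2 - (P (eta A 0 y) + \<theta> 0 * Q (eta A 0 y))) \<le> 0"
    and wall: "P 0 = 0" "Q 0 = 0"
    and xy: "0 \<le> x" "0 \<le> y"
  shows "s * ((u x y)\<^sup>2 - (P (eta A x y) + \<theta> x * Q (eta A x y))) \<le> 0"
proof -
  define X where "X = x + 1"
  have X: "0 < X" "x \<le> X" using xy by (auto simp: X_def)
  have \<theta>c: "continuous_on {0..} \<theta>"
    by (rule DERIV_continuous_on[where D = \<theta>']) (use \<theta> in \<open>auto intro: has_field_derivative_at_within\<close>)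
  have "compact (\<theta> ` {0..X})"
    by (intro compact_continuous_image continuous_on_subset[OF \<theta>c]) auto
  then obtain B where B: "\<And>z. z \<in> \<theta> ` {0..X} \<Longrightarrow> norm z \<le> B"
    using compact_imp_bounded bounded_iff by metis
  let ?e = "eta A"
  let ?S = "\<lambda>x. sqrt (2 * (x + A))"
  let ?ey = "\<lambda>x y. u x y / (?S x * f1 (?e x y))"
  let ?ex = "\<lambda>x y. (- v x y / ?S x - f (?e x y) / (2 * (x + A))) / f1 (?e x y)"
  let ?D1 = "\<lambda>x y. P' (?e x y) + \<theta> x * Q' (?e x y)"
  let ?D2 = "\<lambda>x y. P'' (?e x y) + \<theta> x * Q'' (?e x y)"
  let ?eyy = "\<lambda>x y. (Dy u x y * (?S x * f1 (?e x y)) - u x y * (?S x * (f2 (?e x y) * ?ey x y)))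
      / ((?S x * f1 (?e x y)) * (?S x * f1 (?e x y)))"
  have e: "0 < ?e x y" and f1e: "0 < f1 (?e x y)" if "0 < x" "0 < y" for x y
    using that eta_pos[of x y] f1_pos by auto
  have S: "0 < ?S x" "?S x * ?S x = 2 * (x + A)" if "0 < x" for x using that A by auto
  note ex = eta_deriv_x and ey = eta_deriv_y[OF less_imp_le]
  have eyy: "((\<lambda>y. ?ey x y) has_real_derivative ?eyy x y) (at y)" if "0 < x" "0 < y" for x y
  proof (rule DERIV_divide)
    show "(u x has_real_derivative Dy u x y) (at y)" using u_deriv_y that by simp
    have "((\<lambda>y. f1 (?e x y)) has_real_derivative f2 (?e x y) * ?ey x y) (at y)"
      by (rule DERIV_chain'[OF ey f1_deriv]) (use that e in auto)
    then show "((\<lambda>y. ?S x * f1 (?e x y)) has_real_derivative ?S x * (f2 (?e x y) * ?ey x y)) (at y)"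
      by (rule DERIV_cmult)
    show "?S x * f1 (?e x y) \<noteq> 0" using S[of x] f1e[of x y] that by simp
  qed
  have chain: "((\<lambda>x. g (?e x y)) has_real_derivative g' (?e x y) * ?ex x y) (at x)"
    "((\<lambda>y. g (?e x y)) has_real_derivative g' (?e x y) * ?ey x y) (at y)"
    if "0 < x" "0 < y" "\<And>t. 0 < t \<Longrightarrow> (g has_real_derivative g' t) (at t)" for x y g g'
    using DERIV_chain'[OF ex that(3)[OF e]] DERIV_chain'[OF ey that(3)[OF e]] that(1,2) by auto
  show ?thesis
  proof (rule barrier_comparison[where X = X and K = "K + B * K"
      and \<beta> = "\<lambda>x y. P (?e x y) + \<theta> x * Q (?e x y)"
      and \<beta>x = "\<lambda>x y. ?D1 x y * ?ex x y + \<theta>' x * Q (?e x y)"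
      and \<beta>y = "\<lambda>x y. ?D1 x y * ?ey x y"
      and \<beta>yy = "\<lambda>x y. ?D2 x y * (?ey x y)\<^sup>2 + ?D1 x y * ?eyy x y"])
    have ec: "continuous_on ({0..X} \<times> {0..}) (\<lambda>z. ?e (fst z) (snd z))"
      using eta_cont[OF X(1)] by (simp add: case_prod_unfold)
    have "continuous_on ({0..X} \<times> {0..}) (\<lambda>z. P (?e (fst z) (snd z)))"
      "continuous_on ({0..X} \<times> {0..}) (\<lambda>z. Q (?e (fst z) (snd z)))"
      by (rule continuous_on_compose2[OF Pc ec] continuous_on_compose2[OF Qc ec]; use eta_nonneg in force)+
    moreover have "continuous_on ({0..X} \<times> {0::real..}) (\<lambda>z. \<theta> (fst z))"
      by (rule continuous_on_compose2[OF \<theta>c]) (auto intro!: continuous_intros)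
    ultimately show "continuous_on ({0..X} \<times> {0..}) (\<lambda>(x, y). P (?e x y) + \<theta> x * Q (?e x y))"
      by (auto simp: case_prod_unfold intro!: continuous_intros)
    show "\<bar>P (?e x y) + \<theta> x * Q (?e x y)\<bar> \<le> K + B * K" if "0 \<le> x" "x \<le> X" "0 \<le> y" for x y
    proof -
      have "\<bar>\<theta> x\<bar> \<le> B" using B[of "\<theta> x"] that by auto
      then have "\<bar>\<theta> x * Q (?e x y)\<bar> \<le> B * K"
        unfolding abs_mult using Qb eta_nonneg that by (intro mult_mono) auto
      then show ?thesis using Pb[of "?e x y"] eta_nonneg[of x y] that by (smt (verit))
    qed
    fix x y :: real assume x: "0 < x" and y: "0 < y"
    show "((\<lambda>x. P (?e x y) + \<theta> x * Q (?e x y)) has_real_derivative ?D1 x y * ?ex x y + \<theta>' x * Q (?e x y)) (at x)"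
    proof (rule DERIV_cong[OF DERIV_add[OF chain(1)[OF x y P] DERIV_mult[OF \<theta> chain(1)[OF x y Q]]]])
      have "a * e + (t' * q + b * e * t) = (a + t * b) * e + t' * q" for a b e q t t' :: real
        by (simp add: algebra_simps)
      then show "P' (?e x y) * ?ex x y + (\<theta>' x * Q (?e x y) + Q' (?e x y) * ?ex x y * \<theta> x)
        = ?D1 x y * ?ex x y + \<theta>' x * Q (?e x y)" .
    qed (use x in auto)
    show "((\<lambda>y. P (?e x y) + \<theta> x * Q (?e x y)) has_real_derivative ?D1 x y * ?ey x y) (at y)"
    proof (rule DERIV_cong[OF DERIV_add[OF chain(2)[OF x y P] DERIV_cmult[OF chain(2)[OF x y Q]]]])
      have "a * e + t * (b * e) = (a + t * b) * e" for a b e t :: real by (simp add: algebra_simps)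
      then show "P' (?e x y) * ?ey x y + \<theta> x * (Q' (?e x y) * ?ey x y) = ?D1 x y * ?ey x y" .
    qed
    show "((\<lambda>y. ?D1 x y * ?ey x y) has_real_derivative ?D2 x y * (?ey x y)\<^sup>2 + ?D1 x y * ?eyy x y) (at y)"
    proof (rule DERIV_cong[OF DERIV_mult[OF DERIV_add[OF chain(2)[OF x y P']
          DERIV_cmult[OF chain(2)[OF x y Q']]] eyy[OF x y]]])
      have "(a * e + t * (b * e)) * e + d * c = (a + t * b) * e\<^sup>2 + c * d" for a b c d e t :: real
        by (simp add: algebra_simps power2_eq_square)
      then show "(P'' (?e x y) * ?ey x y + \<theta> x * (Q'' (?e x y) * ?ey x y)) * ?ey x y + ?eyy x y * ?D1 x y
        = ?D2 x y * (?ey x y)\<^sup>2 + ?D1 x y * ?eyy x y" .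
    qed
    assume pos: "0 < s * ((u x y)\<^sup>2 - (P (?e x y) + \<theta> x * Q (?e x y)))"
    define t where "t = ?e x y"
    define r where "r = u x y / f1 t"
    define T where "T = ?S x"
    have t: "0 < t" and f1t: "0 < f1 t" using e f1e x y by (auto simp: t_def)
    have T: "0 < T" "2 * (x + A) = T * T" using S[OF x] by (auto simp: T_def)
    have u: "0 < u x y" using u_pos x y by simp
    have r: "0 < r" "u x y = r * f1 t" using u f1t by (auto simp: r_def)
    have r2: "r\<^sup>2 * (f1 t)\<^sup>2 = (u x y)\<^sup>2" using r by (simp add: power_mult_distrib)
    let ?op = "2 * (x + A) * f1 t * \<theta>' x * Q t - f t * (P' t + \<theta> x * Q' t)
          - r * (P'' t + \<theta> x * Q'' t - f2 t / f1 t * (P' t + \<theta> x * Q' t))"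
    have "0 \<le> s * ?op"
      by (rule barrier[OF x y t_def t r_def r(1)]) (use pos r2 in \<open>simp add: t_def\<close>)
    moreover have "u x y * (?D1 x y * ?ex x y + \<theta>' x * Q (?e x y)) + drift x y * (?D1 x y * ?ey x y)
      - (?D2 x y * (?ey x y)\<^sup>2 + ?D1 x y * ?eyy x y) = u x y / (T * T * f1 t) * ?op"
    proof -
      define d1 d2 where "d1 = P' t + \<theta> x * Q' t" and "d2 = P'' t + \<theta> x * Q'' t"
      have "r * f1 t * (d1 * ((- v x y / T - f t / (T * T)) / f1 t) + \<theta>' x * Q t)
         + (v x y + Dy u x y / (r * f1 t)) * (d1 * (r * f1 t / (T * f1 t)))
         - (d2 * (r * f1 t / (T * f1 t))\<^sup>2 + d1 * ((Dy u x y * (T * f1 t)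
             - r * f1 t * (T * (f2 t * (r * f1 t / (T * f1 t))))) / ((T * f1 t) * (T * f1 t))))
         = r * f1 t / (T * T * f1 t) * (T * T * f1 t * \<theta>' x * Q t - f t * d1 - r * (d2 - f2 t / f1 t * d1))"
        using T(1) f1t r(1) by (simp add: field_simps power2_eq_square)
      then show ?thesis
        unfolding drift_def t_def[symmetric] T_def[symmetric] unfolding T(2) r(2) d1_def d2_def .
    qed
    moreover have "0 \<le> u x y / (T * T * f1 t)" using u T f1t by simp
    ultimately show "0 \<le> s * (u x y * (?D1 x y * ?ex x y + \<theta>' x * Q (?e x y)) + drift x y * (?D1 x y * ?ey x y)
      - (?D2 x y * (?ey x y)\<^sup>2 + ?D1 x y * ?eyy x y))"
      by (metis mult.left_commute mult_nonneg_nonneg)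
  qed (use X s xy initial wall in auto)
qed

end

end

section \<open>Decay along the streamlines\<close>

context blasius begin

lemma f1_square_deriv:
  assumes "0 < t"
  shows "((\<lambda>t. (f1 t)\<^sup>2) has_real_derivative 2 * f1 t * f2 t) (at t)"
    and "((\<lambda>t. 2 * f1 t * f2 t) has_real_derivative 2 * (f2 t)\<^sup>2 - 2 * f t * f1 t * f2 t) (at t)"
  using assms by (auto intro!: derivative_eq_intros f1_deriv f2_deriv simp: power2_eq_square algebra_simps)

lemma f1_square_cont: "continuous_on {0..} (\<lambda>t. (f1 t)\<^sup>2)"
  by (intro continuous_intros f1_cont)

lemma f1_square_le_1: "0 \<le> t \<Longrightarrow> (f1 t)\<^sup>2 \<le> 1"
  using f1_nonneg[of t] f1_le_1[of t] by (simp add: power_le_one)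

text \<open>
  The left side is \<open>\<beta>\<^sub>\<eta>\<^sub>\<eta> - (f'' / f') \<beta>\<^sub>\<eta>\<close> for \<open>\<beta> = f'\<^sup>2\<close>. The result is \<open>- f \<beta>\<^sub>\<eta>\<close>, so that \<open>f'\<^sup>2\<close>
  satisfies the barrier condition with equality for \<open>r = 1\<close>, and up to \<open>2 (r - 1) f f' f''\<close> in general.
\<close>

lemma blasius_operator:
  assumes "0 < t"
  shows "2 * (f2 t)\<^sup>2 - 2 * f t * f1 t * f2 t - f2 t / f1 t * (2 * f1 t * f2 t) = - 2 * f t * f1 t * f2 t"
  using f1_pos[OF assms] by (simp add: power2_eq_square)

end

context blasius_comparison begin

context
  fixes A :: real
  assumes A: "0 < A"
begin

text \<open>Where \<open>u\<close> is below the Blasius velocity, \<open>r < 1\<close> gives \<open>2 (r - 1) f f' f''\<close> the sign of a subsolution.\<close>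

lemma blasius_lower_bound:
  assumes initial: "\<And>y. 0 \<le> y \<Longrightarrow> (f1 (eta A 0 y))\<^sup>2 \<le> (u 0 y)\<^sup>2"
    and xy: "0 \<le> x" "0 \<le> y"
  shows "(f1 (eta A x y))\<^sup>2 \<le> (u x y)\<^sup>2"
proof -
  have "(- 1) * ((u x y)\<^sup>2 - ((f1 (eta A x y))\<^sup>2 + (\<lambda>_. 0) x * (\<lambda>_. 0) (eta A x y))) \<le> 0"
  proof (rule similarity_comparison[OF A, where s = "- 1" and K = 1
        and P = "\<lambda>t. (f1 t)\<^sup>2" and P' = "\<lambda>t. 2 * f1 t * f2 t"
        and P'' = "\<lambda>t. 2 * (f2 t)\<^sup>2 - 2 * f t * f1 t * f2 t"
        and Q = "\<lambda>_. 0" and Q' = "\<lambda>_. 0" and Q'' = "\<lambda>_. 0" and \<theta> = "\<lambda>_. 0" and \<theta>' = "\<lambda>_. 0"])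
    fix x t r :: real
    assume t: "0 < t" and r: "0 < r" and neg: "0 < (- 1) * (r\<^sup>2 * (f1 t)\<^sup>2 - ((f1 t)\<^sup>2 + 0 * 0))"
    have "r\<^sup>2 * (f1 t)\<^sup>2 < 1 * (f1 t)\<^sup>2" using neg by simp
    then have "r\<^sup>2 < 1" using f1_pos[OF t] by (simp only: mult_less_cancel_right_pos zero_less_power)
    then have "r < 1" using r by (simp add: power_less_one_iff)
    then have "0 \<le> (1 - r) * (2 * f t * f1 t * f2 t)"
      using f_pos[OF t] f1_pos[OF t] f2_pos[of t] t by simp
    also have "(1 - r) * (2 * f t * f1 t * f2 t) = (- 1) * (- f t * (2 * f1 t * f2 t) - r * (- 2 * f t * f1 t * f2 t))"
      by (simp add: algebra_simps)
    finally show "0 \<le> (- 1) * (2 * (x + A) * f1 t * 0 * 0 - f t * (2 * f1 t * f2 t + 0 * 0)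
      - r * (2 * (f2 t)\<^sup>2 - 2 * f t * f1 t * f2 t + 0 * 0 - f2 t / f1 t * (2 * f1 t * f2 t + 0 * 0)))"
      unfolding blasius_operator[OF t, symmetric] by simp
  qed (use initial xy f1_square_deriv f1_square_cont f1_square_le_1 in auto)
  then show ?thesis by simp
qed

text \<open>
  As \<open>f'\<^sup>2\<close> is concave in \<open>\<psi>\<close>, the diffusion \<open>u \<partial>\<^sub>\<psi>\<^sub>\<psi>\<close> lowers it faster the larger \<open>u\<close> is; so \<open>k f'\<^sup>2\<close> is
  a supersolution wherever \<open>u\<^sup>2\<close> exceeds it.
\<close>

lemma blasius_multiple_upper_bound:
  assumes k: "1 \<le> k"
    and initial: "\<And>y. 0 \<le> y \<Longrightarrow> (u 0 y)\<^sup>2 \<le> k * (f1 (eta A 0 y))\<^sup>2"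
    and xy: "0 \<le> x" "0 \<le> y"
  shows "(u x y)\<^sup>2 \<le> k * (f1 (eta A x y))\<^sup>2"
proof -
  have "1 * ((u x y)\<^sup>2 - (k * (f1 (eta A x y))\<^sup>2 + (\<lambda>_. 0) x * (\<lambda>_. 0) (eta A x y))) \<le> 0"
  proof (rule similarity_comparison[OF A, where s = 1 and K = k
        and P = "\<lambda>t. k * (f1 t)\<^sup>2" and P' = "\<lambda>t. k * (2 * f1 t * f2 t)"
        and P'' = "\<lambda>t. k * (2 * (f2 t)\<^sup>2 - 2 * f t * f1 t * f2 t)"
        and Q = "\<lambda>_. 0" and Q' = "\<lambda>_. 0" and Q'' = "\<lambda>_. 0" and \<theta> = "\<lambda>_. 0" and \<theta>' = "\<lambda>_. 0"])
    show "\<bar>k * (f1 t)\<^sup>2\<bar> \<le> k" if "0 \<le> t" for t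
      using mult_left_mono[OF f1_square_le_1[OF that], of k] k by simp
    fix x t r :: real
    assume t: "0 < t" and r: "0 < r" and pos: "0 < 1 * (r\<^sup>2 * (f1 t)\<^sup>2 - (k * (f1 t)\<^sup>2 + 0 * 0))"
    have "k * (f1 t)\<^sup>2 < r\<^sup>2 * (f1 t)\<^sup>2" using pos by simp
    then have "k < r\<^sup>2" using f1_pos[OF t] by (simp only: mult_less_cancel_right_pos zero_less_power)
    then have "1\<^sup>2 < r\<^sup>2" using k by simp
    then have "1 < r" by (rule power_less_imp_less_base) (use r in simp)
    then have "0 \<le> k * ((r - 1) * (2 * f t * f1 t * f2 t))"
      using f_pos[OF t] f1_pos[OF t] f2_pos[of t] t k by simp
    also have "\<dots> = - f t * (k * (2 * f1 t * f2 t)) - r * (k * (- 2 * f t * f1 t * f2 t))"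
      by (simp add: algebra_simps)
    also have "k * (- 2 * f t * f1 t * f2 t) = k * (2 * (f2 t)\<^sup>2 - 2 * f t * f1 t * f2 t)
        - f2 t / f1 t * (k * (2 * f1 t * f2 t))"
      unfolding blasius_operator[OF t, symmetric] right_diff_distrib by (simp only: mult.left_commute)
    finally show "0 \<le> 1 * (2 * (x + A) * f1 t * 0 * 0 - f t * (k * (2 * f1 t * f2 t) + 0 * 0)
      - r * (k * (2 * (f2 t)\<^sup>2 - 2 * f t * f1 t * f2 t) + 0 * 0 - f2 t / f1 t * (k * (2 * f1 t * f2 t) + 0 * 0)))"
      by (simp only: mult_zero_left mult_zero_right add_0_right diff_0 mult_1 minus_mult_left[symmetric])
  next
    show "continuous_on {0..} (\<lambda>t. k * (f1 t)\<^sup>2)" by (intro continuous_intros f1_square_cont)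
    show "((\<lambda>t. k * (f1 t)\<^sup>2) has_real_derivative k * (2 * f1 t * f2 t)) (at t)"
      "((\<lambda>t. k * (2 * f1 t * f2 t)) has_real_derivative k * (2 * (f2 t)\<^sup>2 - 2 * f t * f1 t * f2 t)) (at t)"
      if "0 < t" for t
      using f1_square_deriv[OF that] by (auto intro: DERIV_cmult)
  qed (use initial xy k in auto)
  then show ?thesis by simp
qed

end

end

context blasius begin

text \<open>
  For the barrier \<open>f'\<^sup>2 (1 + \<theta> m)\<close> with \<open>m = 1 / (1 + b t\<^sup>2)\<close> and \<open>\<theta>\<close> proportional to \<open>(x + A)\<^sup>-\<^sup>c\<close>, the
  barrier condition, divided by \<open>\<theta> f'\<close>, follows from
  \<open>2 c f'\<^sup>2 m + r f' m'' \<le> f f'' m - (f f' + 3 r f'') m'\<close>.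
  For \<open>t \<le> 1\<close>, the damping \<open>f f'' m\<close> dominates the \<open>c\<close>-term and \<open>3 r f'' m'\<close> dominates \<open>r f' m''\<close>. Far
  out \<open>f''\<close> is exponentially small, and the transport \<open>f f' m'\<close> of the decreasing weight dominates both;
  a small \<open>b\<close>, depending on \<open>R\<close>, keeps \<open>m''\<close> small against \<open>m'\<close>.
\<close>

lemma weight_inequality:
  assumes R: "1 \<le> R"
  obtains b c where "0 < b" "b \<le> 1/2" "0 < c"
    "\<And>t r. 0 < t \<Longrightarrow> 1 \<le> r \<Longrightarrow> r \<le> R \<Longrightarrow>
      2 * c * (f1 t)\<^sup>2 * (1 / (1 + b * t\<^sup>2))
        + r * f1 t * (8 * b\<^sup>2 * t\<^sup>2 * (1 / (1 + b * t\<^sup>2))^3 - 2 * b * (1 / (1 + b * t\<^sup>2))\<^sup>2)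
      \<le> f t * f2 t * (1 / (1 + b * t\<^sup>2))
        + (f t * f1 t + 3 * r * f2 t) * (2 * b * t * (1 / (1 + b * t\<^sup>2))\<^sup>2)"
proof -
  define a where "a = f2 0"
  (* the bounds f2 1 / a and f2 1 / (4 * a) serve t \<le> 1, the other ones t \<ge> 1 *)
  define b where "b = min (1/2) (min (f2 1 / a) (f 1 / (6 * R)))"
  define c where "c = min (f2 1 / (4 * a)) (f 1 * b / 4)"
  have pos: "0 < a" "0 < f2 1" "0 < f 1" using f2_pos[of 0] f2_pos[of 1] f_pos[of 1] by (auto simp: a_def)
  have b: "0 < b" "b \<le> 1/2" "b \<le> f2 1 / a" "b \<le> f 1 / (6 * R)"
  proof -
    show "0 < b" using pos R by (simp add: b_def)
    have "b \<le> min (f2 1 / a) (f 1 / (6 * R))" unfolding b_def by (rule min.cobounded2)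
    then show "b \<le> f2 1 / a" "b \<le> f 1 / (6 * R)" by simp_all
    show "b \<le> 1/2" unfolding b_def by (rule min.cobounded1)
  qed
  have b': "b * a \<le> f2 1" "6 * R * b \<le> f 1" using b(3,4) pos R by (auto simp: field_simps)
  have c: "0 < c" "c \<le> f2 1 / (4 * a)" "c \<le> f 1 * b / 4"
    using pos b by (auto simp: c_def)
  have c': "4 * a * c \<le> f2 1" "4 * c \<le> f 1 * b" using c(2,3) pos by (auto simp: field_simps)
  show ?thesis
  proof (rule that[OF b(1,2) c(1)])
    fix t r :: real assume t: "0 < t" and r: "1 \<le> r" "r \<le> R"
    define m where "m = 1 / (1 + b * t\<^sup>2)"
    have den: "1 \<le> 1 + b * t\<^sup>2" using b by simp
    have m: "0 < m" "m \<le> 1" using den by (auto simp: m_def)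
    have meq: "b * t\<^sup>2 * m = 1 - m" using den by (simp add: m_def field_simps)
    have F: "0 < f t" "0 < f1 t" "f1 t \<le> 1" "0 < f2 t"
      using t f_pos f1_pos f1_le_1[of t] f2_pos[of t] by auto
    have "b * t\<^sup>2 * m * (b * m\<^sup>2) = (1 - m) * (b * m\<^sup>2)" using meq by simp
    then have "8 * b\<^sup>2 * t\<^sup>2 * m^3 - 2 * b * m\<^sup>2 = 6 * b\<^sup>2 * t\<^sup>2 * m^3 - 2 * b * m^3"
      by (simp add: power2_eq_square power3_eq_cube algebra_simps)
    also have "\<dots> \<le> 6 * b\<^sup>2 * t\<^sup>2 * m^3" using b m by simp
    finally have m2: "r * f1 t * (8 * b\<^sup>2 * t\<^sup>2 * m^3 - 2 * b * m\<^sup>2) \<le> r * f1 t * (6 * b\<^sup>2 * t\<^sup>2 * m^3)"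
      using r F by (intro mult_left_mono) auto
    have main: "2 * c * (f1 t)\<^sup>2 * m + r * f1 t * (6 * b\<^sup>2 * t\<^sup>2 * m^3)
      \<le> f t * f2 t * m + (f t * f1 t + 3 * r * f2 t) * (2 * b * t * m\<^sup>2)"
    proof (cases "t \<le> 1")
      case True
      have f2t: "f2 1 \<le> f2 t" using f2_antimono[of t 1] True t by simp
      have "2 * c * (f1 t)\<^sup>2 \<le> 2 * c * (2 * a * f t)"
        using f1_square_le[of t] t c by (intro mult_left_mono) (auto simp: a_def)
      also have "\<dots> = 4 * a * c * f t" by simp
      also have "\<dots> \<le> f2 t * f t" using c'(1) f2t F by (intro mult_right_mono) auto
      finally have 1: "2 * c * (f1 t)\<^sup>2 * m \<le> f t * f2 t * m"
        using m by (simp add: mult.commute)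
      have "f1 t * (b * t * m) \<le> a * (b * 1 * 1)"
        using f1_le[of t] True t m b F
        by (intro mult_mono mult_nonneg_nonneg order_trans[OF f1_le[of t]]) (auto simp: a_def f2_pos less_imp_le mult_left_le)
      also have "\<dots> \<le> f2 t" using b'(1) f2t by (simp add: mult.commute)
      finally have "6 * r * b * t * m\<^sup>2 * (f1 t * (b * t * m)) \<le> 6 * r * b * t * m\<^sup>2 * f2 t"
        using r b t m by (intro mult_left_mono) auto
      then have 2: "r * f1 t * (6 * b\<^sup>2 * t\<^sup>2 * m^3) \<le> 3 * r * f2 t * (2 * b * t * m\<^sup>2)"
        by (simp add: power2_eq_square power3_eq_cube algebra_simps)
      have "0 \<le> f t * f1 t * (2 * b * t * m\<^sup>2)" using F b t by simp
      with 1 2 show ?thesis by (simp only: distrib_right)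
    next
      case False
      then have t1: "1 \<le> t" by simp
      have ft: "f 1 * t \<le> f t" using f_linear_lower[of 1 t] t1 by simp
      define q where "q = b * t\<^sup>2 * m"
      have q: "0 \<le> q" "q \<le> 1" using meq m b by (auto simp: q_def)
      have q2: "b \<le> 2 * q"
      proof -
        have "1 \<le> t\<^sup>2" using t1 by (simp add: power2_eq_square mult_ge1_I)
        moreover have "b * t\<^sup>2 \<le> 1 * t\<^sup>2" using b by (intro mult_right_mono) auto
        ultimately have "b * (1 + b * t\<^sup>2) \<le> b * (2 * t\<^sup>2)" using b by (intro mult_left_mono) auto
        then show ?thesis using den by (simp add: q_def m_def field_simps)
      qed
      have cq: "2 * c \<le> f 1 * q"
      proof -
        have "f 1 * b \<le> f 1 * (2 * q)" using q2 pos by (intro mult_left_mono) auto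
        then show ?thesis using c'(2) by linarith
      qed
      have "(f1 t)\<^sup>2 * m \<le> f1 t * m"
        using F m by (intro mult_right_mono) (auto simp: power2_eq_square mult_left_le)
      then have "2 * c * ((f1 t)\<^sup>2 * m) \<le> f 1 * q * (f1 t * m)"
        by (rule mult_mono[OF cq]) (use F m q pos in auto)
      then have "2 * c * (f1 t)\<^sup>2 * m \<le> f 1 * q * (f1 t * m)" by (simp only: mult.assoc)
      moreover have "r * f1 t * (6 * b\<^sup>2 * t\<^sup>2 * m^3) \<le> f 1 * q * (f1 t * m)"
      proof -
        have "6 * r * b * m \<le> f 1"
        proof -
          have "6 * r * b * m \<le> 6 * R * b * 1" using r b m by (intro mult_mono) auto
          then show ?thesis using b'(2) by simp
        qed
        then have "6 * r * b * m * (q * (f1 t * m)) \<le> f 1 * (q * (f1 t * m))"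
          using q F m by (intro mult_right_mono) auto
        then show ?thesis by (simp add: q_def power2_eq_square power3_eq_cube algebra_simps)
      qed
      moreover have "2 * (f 1 * q * (f1 t * m)) \<le> f t * f1 t * (2 * b * t * m\<^sup>2)"
      proof -
        have "f 1 * t * (2 * f1 t * b * t * m\<^sup>2) \<le> f t * (2 * f1 t * b * t * m\<^sup>2)"
          using ft F b t by (intro mult_right_mono) auto
        then show ?thesis by (simp add: q_def power2_eq_square algebra_simps)
      qed
      moreover have "0 \<le> f t * f2 t * m" "0 \<le> 3 * r * f2 t * (2 * b * t * m\<^sup>2)" using F b t m r by auto
      ultimately show ?thesis by (simp only: distrib_right)
    qed
    show "2 * c * (f1 t)\<^sup>2 * (1 / (1 + b * t\<^sup>2))
        + r * f1 t * (8 * b\<^sup>2 * t\<^sup>2 * (1 / (1 + b * t\<^sup>2))^3 - 2 * b * (1 / (1 + b * t\<^sup>2))\<^sup>2)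
      \<le> f t * f2 t * (1 / (1 + b * t\<^sup>2))
        + (f t * f1 t + 3 * r * f2 t) * (2 * b * t * (1 / (1 + b * t\<^sup>2))\<^sup>2)"
      unfolding m_def[symmetric] using main m2 by linarith
  qed
qed

text \<open>
  Where \<open>w = r\<^sup>2 f'\<^sup>2\<close> exceeds a barrier \<open>f'\<^sup>2 + g\<close>, the favourable term \<open>2 (r - 1) f f' f''\<close> is of the
  order of \<open>g\<close>: it is the damping that the nonlinear coefficient contributes.
\<close>

lemma ratio_excess:
  fixes r g F :: real
  assumes "0 < r" "0 < F" "0 \<le> g" "0 < r\<^sup>2 * F - (F + g)"
  shows "1 < r" "g \<le> (r - 1) * (r + 1) * F"
proof -
  have *: "(r - 1) * (r + 1) * F = r\<^sup>2 * F - F" by (simp add: power2_eq_square algebra_simps)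
  then show "g \<le> (r - 1) * (r + 1) * F" using assms(4) by linarith
  have "0 < (r - 1) * ((r + 1) * F)" using * assms(3,4) by (simp add: mult.assoc)
  moreover have "0 < (r + 1) * F" using assms(1,2) by simp
  ultimately have "0 < r - 1" by (rule zero_less_mult_pos2)
  then show "1 < r" by simp
qed

end

context blasius_comparison begin

context
  fixes A :: real
  assumes A: "0 < A"
begin

text \<open>
  The weight \<open>1 / (1 + b \<eta>\<^sup>2)\<close> is there to tame a factor \<open>\<eta>\<^sup>2\<close> in \<open>sharp_decay\<close>, for which algebraic
  decay suffices. The rate \<open>c\<close> may be small.
\<close>

lemma weighted_decay:
  assumes R: "1 \<le> R" and upper: "\<And>x y. 0 \<le> x \<Longrightarrow> 0 \<le> y \<Longrightarrow> (u x y)\<^sup>2 \<le> R\<^sup>2 * (f1 (eta A x y))\<^sup>2"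
    and b: "0 < b" and c: "0 < c"
    and weight: "\<And>t r. 0 < t \<Longrightarrow> 1 \<le> r \<Longrightarrow> r \<le> R \<Longrightarrow>
      2 * c * (f1 t)\<^sup>2 * (1 / (1 + b * t\<^sup>2))
        + r * f1 t * (8 * b\<^sup>2 * t\<^sup>2 * (1 / (1 + b * t\<^sup>2))^3 - 2 * b * (1 / (1 + b * t\<^sup>2))\<^sup>2)
      \<le> f t * f2 t * (1 / (1 + b * t\<^sup>2))
        + (f t * f1 t + 3 * r * f2 t) * (2 * b * t * (1 / (1 + b * t\<^sup>2))\<^sup>2)"
    and N: "0 < N"
    and initial: "\<And>y. 0 \<le> y \<Longrightarrow> (u 0 y)\<^sup>2 \<le> (f1 (eta A 0 y))\<^sup>2
        + N * A powr (- c) * ((f1 (eta A 0 y))\<^sup>2 * (1 / (1 + b * (eta A 0 y)\<^sup>2)))"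
    and xy: "0 \<le> x" "0 \<le> y"
  shows "(u x y)\<^sup>2 \<le> (f1 (eta A x y))\<^sup>2
      + N * (x + A) powr (- c) * ((f1 (eta A x y))\<^sup>2 * (1 / (1 + b * (eta A x y)\<^sup>2)))"
proof -
  define m m1 m2 where "m t = 1 / (1 + b * t\<^sup>2)" and "m1 t = - 2 * b * t * (m t)\<^sup>2"
    and "m2 t = 8 * b\<^sup>2 * t\<^sup>2 * (m t)^3 - 2 * b * (m t)\<^sup>2" for t
  have den: "1 \<le> 1 + b * t\<^sup>2" for t :: real using b by simp
  have den0: "1 + b * t\<^sup>2 \<noteq> 0" for t :: real using den[of t] by linarith
  have m: "0 < m t" "m t \<le> 1" for t using den[of t] by (auto simp: m_def)
  have dm: "(m has_real_derivative m1 t) (at t)" for t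
    unfolding m_def m1_def using den0[of t]
    by (auto intro!: derivative_eq_intros simp: power2_eq_square field_simps)
  have dm1: "(m1 has_real_derivative m2 t) (at t)" for t
    unfolding m1_def[abs_def] m2_def
    by (auto intro!: derivative_eq_intros dm simp: m1_def power2_eq_square power3_eq_cube algebra_simps)
  define Q Q1 Q2 where "Q t = (f1 t)\<^sup>2 * m t"
    and "Q1 t = 2 * f1 t * f2 t * m t + (f1 t)\<^sup>2 * m1 t"
    and "Q2 t = (2 * (f2 t)\<^sup>2 - 2 * f t * f1 t * f2 t) * m t + 2 * (2 * f1 t * f2 t * m1 t) + (f1 t)\<^sup>2 * m2 t" for t
  have dQ: "(Q has_real_derivative Q1 t) (at t)" and dQ1: "(Q1 has_real_derivative Q2 t) (at t)" if "0 < t" for t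
  proof -
    note d = f1_square_deriv[OF that]
    show "(Q has_real_derivative Q1 t) (at t)"
      unfolding Q_def[abs_def] by (rule DERIV_cong[OF DERIV_mult[OF d(1) dm]]) (simp add: Q1_def)
    show "(Q1 has_real_derivative Q2 t) (at t)"
      unfolding Q1_def[abs_def]
      by (rule DERIV_cong[OF DERIV_add[OF DERIV_mult[OF d(2) dm] DERIV_mult[OF d(1) dm1]]]) (simp add: Q2_def)
  qed
  define \<theta> where "\<theta> x = N * (x + A) powr (- c)" for x
  define \<theta>' where "\<theta>' x = - c * \<theta> x / (x + A)" for x
  have d\<theta>: "(\<theta> has_real_derivative \<theta>' x) (at x)" if "0 \<le> x" for x
  proof -
    have "0 < x + A" using that A by simp
    then show ?thesis unfolding \<theta>_def[abs_def] \<theta>'_def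
      by (auto intro!: derivative_eq_intros simp: powr_diff \<theta>_def)
  qed
  have \<theta>pos: "0 < \<theta> x" if "0 \<le> x" for x using that A N by (simp add: \<theta>_def)
  have "1 * ((u x y)\<^sup>2 - ((f1 (eta A x y))\<^sup>2 + \<theta> x * Q (eta A x y))) \<le> 0"
  proof (rule similarity_comparison[OF A, where s = 1 and K = 1
        and P = "\<lambda>t. (f1 t)\<^sup>2" and P' = "\<lambda>t. 2 * f1 t * f2 t"
        and P'' = "\<lambda>t. 2 * (f2 t)\<^sup>2 - 2 * f t * f1 t * f2 t"
        and Q = Q and Q' = Q1 and Q'' = Q2 and \<theta> = \<theta> and \<theta>' = \<theta>'])
    have mc: "continuous_on {0..} m" unfolding m_def using den0 by (intro continuous_intros) auto
    show "continuous_on {0..} Q" unfolding Q_def by (intro continuous_intros f1_cont mc)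
    show "\<bar>Q t\<bar> \<le> 1" if "0 \<le> t" for t
      using mult_le_one[of "(f1 t)\<^sup>2" "m t"] f1_square_le_1[OF that] m[of t] by (simp add: Q_def)
    show "1 * ((u 0 y)\<^sup>2 - ((f1 (eta A 0 y))\<^sup>2 + \<theta> 0 * Q (eta A 0 y))) \<le> 0" if "0 \<le> y" for y
      using initial[OF that] by (simp add: \<theta>_def Q_def m_def)
    show "Q 0 = 0" by (simp add: Q_def)
    fix x y t r :: real
    assume x: "0 < x" and y: "0 < y" and te: "t = eta A x y" and t: "0 < t" and re: "r = u x y / f1 t" and r: "0 < r"
      and pos: "0 < 1 * (r\<^sup>2 * (f1 t)\<^sup>2 - ((f1 t)\<^sup>2 + \<theta> x * Q t))"
    have F: "0 < f t" "0 < f1 t" "0 < f2 t" using t f_pos f1_pos f2_pos[of t] by auto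
    define th where "th = \<theta> x"
    have th: "0 < th" using \<theta>pos x by (simp add: th_def)
    have "0 \<le> th * Q t" using th m[of t] by (simp add: Q_def)
    note ex = ratio_excess[of r "(f1 t)\<^sup>2" "th * Q t", OF r _ this]
    have r1: "1 < r" and gap: "th * Q t \<le> (r - 1) * (r + 1) * (f1 t)\<^sup>2"
      using ex pos F by (auto simp: th_def)
    have gap': "th * m t \<le> (r - 1) * (r + 1)"
      using gap F by (simp add: Q_def mult.left_commute[of th])
    have rR: "r \<le> R"
    proof -
      have "r\<^sup>2 * (f1 t)\<^sup>2 \<le> R\<^sup>2 * (f1 t)\<^sup>2"
        using upper[of x y] x y F by (simp add: re te power_divide)
      then have "r\<^sup>2 \<le> R\<^sup>2" using F by simp
      then show ?thesis using R by (simp add: power2_le_iff_abs_le)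
    qed
    (* by gap', 2 * (r - 1) \<ge> 2 * th * m / (r + 1), and 1 / (r + 1) + r - 1 \<ge> 1 / 2 for r \<ge> 1 *)
    have damp: "th * m t \<le> 2 * (r - 1) + 2 * th * m t * (r - 1)"
    proof -
      have "th * m t * (r - 1) \<ge> 0" using th m[of t] r1 by simp
      moreover have "th * m t * (r + 1) \<le> (2 * (r - 1) + 2 * th * m t * (r - 1)) * (r + 1)"
      proof -
        have "th * m t * (r + 1) = 2 * (th * m t) + th * m t * (r - 1)" by (simp add: algebra_simps)
        also have "\<dots> \<le> 2 * ((r - 1) * (r + 1)) + 2 * (th * m t * (r - 1)) * (r + 1)"
        proof -
          have "1 * (th * m t * (r - 1)) \<le> (2 * (r + 1)) * (th * m t * (r - 1))"
            using th m[of t] r1 by (intro mult_right_mono) auto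
          then show ?thesis using gap' by (simp add: algebra_simps)
        qed
        also have "\<dots> = (2 * (r - 1) + 2 * th * m t * (r - 1)) * (r + 1)" by (simp add: algebra_simps)
        finally show ?thesis .
      qed
      ultimately show ?thesis using r1 by simp
    qed
    have w: "2 * c * (f1 t)\<^sup>2 * m t + r * f1 t * m2 t \<le> f t * f2 t * m t - (f t * f1 t + 3 * r * f2 t) * m1 t"
      using weight[of t r] t r1 rR by (simp add: m2_def m1_def m_def)
    have "0 \<le> f t * f2 t * (2 * (r - 1) + 2 * th * m t * (r - 1) - th * m t)
       + th * (f t * f2 t * m t - (f t * f1 t + 3 * r * f2 t) * m1 t - (2 * c * (f1 t)\<^sup>2 * m t + r * f1 t * m2 t))"
      using damp w F th by simp
    then have "0 \<le> f1 t * \<dots>" using F by simp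
    also have "f1 t * (f t * f2 t * (2 * (r - 1) + 2 * th * m t * (r - 1) - th * m t)
       + th * (f t * f2 t * m t - (f t * f1 t + 3 * r * f2 t) * m1 t - (2 * c * (f1 t)\<^sup>2 * m t + r * f1 t * m2 t)))
      = - 2 * c * th * f1 t * Q t - f t * (2 * f1 t * f2 t + th * Q1 t)
        - r * ((2 * (f2 t)\<^sup>2 - 2 * f t * f1 t * f2 t - f2 t / f1 t * (2 * f1 t * f2 t))
           + th * (Q2 t - f2 t / f1 t * Q1 t))"
      unfolding Q_def Q1_def Q2_def using F(2) by (simp add: field_simps power2_eq_square)
    also have "- 2 * c * th * f1 t * Q t = 2 * (x + A) * f1 t * \<theta>' x * Q t"
      using x A by (simp add: \<theta>'_def th_def field_simps)
    finally show "0 \<le> 1 * (2 * (x + A) * f1 t * \<theta>' x * Q t - f t * (2 * f1 t * f2 t + \<theta> x * Q1 t)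
      - r * (2 * (f2 t)\<^sup>2 - 2 * f t * f1 t * f2 t + \<theta> x * Q2 t - f2 t / f1 t * (2 * f1 t * f2 t + \<theta> x * Q1 t)))"
      unfolding th_def by (simp add: algebra_simps)
  qed (use xy d\<theta> dQ dQ1 f1_square_deriv f1_square_cont f1_square_le_1 in auto)
  then show ?thesis by (simp add: \<theta>_def Q_def m_def)
qed


text \<open>
  Shifting the origin \<open>A\<close> generates the exact solution \<open>f f'' / (x + A)\<close> of the linearised equation. The
  assumed decay bounds the error of the linearisation by a multiple of \<open>(x + A)\<^sup>-\<^sup>c\<close>, relative to
  \<open>f f''\<close>. This is integrable with respect to \<open>dx / (x + A)\<close>, so that an amplitude
  \<open>\<theta> = K exp (- D (x + A)\<^sup>-\<^sup>c) / (x + A)\<close>, comparable to \<open>1 / (x + A)\<close>, absorbs it.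
\<close>

lemma sharp_decay:
  assumes b: "0 < b" and c: "0 < c" and M: "0 < M" and N: "0 < N"
    and decay: "\<And>x y. 0 \<le> x \<Longrightarrow> 0 \<le> y \<Longrightarrow> (u x y)\<^sup>2 \<le> (f1 (eta A x y))\<^sup>2
        + M * (x + A) powr (- c) * ((f1 (eta A x y))\<^sup>2 * (1 / (1 + b * (eta A x y)\<^sup>2)))"
    and initial: "\<And>y. 0 \<le> y \<Longrightarrow> (u 0 y)\<^sup>2 \<le> (f1 (eta A 0 y))\<^sup>2 + N * (f (eta A 0 y) * f2 (eta A 0 y))"
  obtains K where "0 < K" "\<And>x y. 0 \<le> x \<Longrightarrow> 0 \<le> y \<Longrightarrow>
    (u x y)\<^sup>2 \<le> (f1 (eta A x y))\<^sup>2 + K / (x + A) * (f (eta A x y) * f2 (eta A x y))"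
proof -
  define Q Q1 Q2 where "Q t = f t * f2 t"
    and "Q1 t = f1 t * f2 t - (f t)\<^sup>2 * f2 t"
    and "Q2 t = (f2 t)\<^sup>2 - 3 * f t * f1 t * f2 t + (f t)^3 * f2 t" for t
  have dQ: "(Q has_real_derivative Q1 t) (at t)" and dQ1: "(Q1 has_real_derivative Q2 t) (at t)" if "0 < t" for t
    unfolding Q_def[abs_def] Q1_def[abs_def] Q2_def using that
    by (auto intro!: derivative_eq_intros f_deriv f1_deriv f2_deriv
        simp: Q1_def power2_eq_square power3_eq_cube algebra_simps)
  (* D is such that 2 * (x + A) * \<theta>' = (- 2 + \<mu> / (2 * b)) * \<theta> for \<mu> = M * (x + A) powr (- c),
     where \<mu> / (2 * b) bounds (r - 1) * \<eta>\<^sup>2; K is such that \<theta> 0 = N *)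
  define D where "D = M / (4 * b * c)"
  define K where "K = N * A * exp (D * A powr (- c))"
  define \<theta> where "\<theta> x = K / (x + A) * exp (- (D * (x + A) powr (- c)))" for x
  define \<theta>' where "\<theta>' x = \<theta> x * (- 1 + M * (x + A) powr (- c) / (4 * b)) / (x + A)" for x
  have K: "0 < K" using N A by (simp add: K_def)
  have D: "0 < D" using M b c by (simp add: D_def)
  have d\<theta>: "(\<theta> has_real_derivative \<theta>' x) (at x)" if "0 \<le> x" for x
  proof -
    have xA: "0 < x + A" using that A by simp
    have "((\<lambda>x. (x + A) powr (- c)) has_real_derivative - c * (x + A) powr (- c) / (x + A)) (at x)"
      using xA by (auto intro!: derivative_eq_intros simp: powr_diff)
    note this[derivative_intros]
    have "(\<theta> has_real_derivative - K / (x + A)\<^sup>2 * exp (- (D * (x + A) powr (- c)))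
        + exp (- (D * (x + A) powr (- c))) * (D * (c * (x + A) powr (- c) / (x + A))) * (K / (x + A))) (at x)"
      unfolding \<theta>_def[abs_def] using xA
      by (auto intro!: derivative_eq_intros simp: power2_eq_square diff_divide_distrib mult_ac)
    also have "D * (c * (x + A) powr (- c) / (x + A)) = M * (x + A) powr (- c) / (4 * b) / (x + A)"
      using c b by (simp add: D_def)
    also have "- K / (x + A)\<^sup>2 * exp (- (D * (x + A) powr (- c)))
        + exp (- (D * (x + A) powr (- c))) * (M * (x + A) powr (- c) / (4 * b) / (x + A)) * (K / (x + A)) = \<theta>' x"
    proof -
      have "- K / z\<^sup>2 * e + e * (w / z) * (K / z) = K / z * e * (- 1 + w) / z" if "0 < z" for z e w :: real
        using that by (simp add: field_simps power2_eq_square)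
      from this[OF xA] show ?thesis unfolding \<theta>'_def \<theta>_def .
    qed
    finally show ?thesis .
  qed
  have \<theta>pos: "0 < \<theta> x" if "0 \<le> x" for x using that A K by (simp add: \<theta>_def)
  have \<theta>le: "\<theta> x \<le> K / (x + A)" if "0 \<le> x" for x
    using that A K D by (simp add: \<theta>_def divide_right_mono mult_left_le)
  have \<theta>0: "\<theta> 0 = N" using A by (simp add: \<theta>_def K_def exp_minus)
  have "(u x y)\<^sup>2 \<le> (f1 (eta A x y))\<^sup>2 + K / (x + A) * (f (eta A x y) * f2 (eta A x y))"
    if xy: "0 \<le> x" "0 \<le> y" for x y
  proof -
    have "1 * ((u x y)\<^sup>2 - ((f1 (eta A x y))\<^sup>2 + \<theta> x * Q (eta A x y))) \<le> 0"
    proof (rule similarity_comparison[OF A, where s = 1 and K = 1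
          and P = "\<lambda>t. (f1 t)\<^sup>2" and P' = "\<lambda>t. 2 * f1 t * f2 t"
          and P'' = "\<lambda>t. 2 * (f2 t)\<^sup>2 - 2 * f t * f1 t * f2 t"
          and Q = Q and Q' = Q1 and Q'' = Q2 and \<theta> = \<theta> and \<theta>' = \<theta>'])
      show "continuous_on {0..} Q" unfolding Q_def by (intro continuous_intros f_cont f2_cont)
      show "\<bar>Q t\<bar> \<le> 1" if "0 \<le> t" for t
      proof -
        have "0 \<le> Q t" using f_nonneg f2_pos[of t] that by (simp add: Q_def)
        moreover have "Q t \<le> 1" using f_f2_le[OF that] f1_square_le_1[OF that] by (simp add: Q_def)
        ultimately show ?thesis by simp
      qed
      show "1 * ((u 0 y)\<^sup>2 - ((f1 (eta A 0 y))\<^sup>2 + \<theta> 0 * Q (eta A 0 y))) \<le> 0" if "0 \<le> y" for y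
        using initial[OF that] by (simp add: \<theta>0 Q_def)
      show "Q 0 = 0" by (simp add: Q_def)
      fix x y t r :: real
      assume x: "0 < x" and y: "0 < y" and te: "t = eta A x y" and t: "0 < t" and re: "r = u x y / f1 t" and r: "0 < r"
        and pos: "0 < 1 * (r\<^sup>2 * (f1 t)\<^sup>2 - ((f1 t)\<^sup>2 + \<theta> x * Q t))"
      have F: "0 < f t" "0 < f1 t" "f1 t \<le> 1" "0 < f2 t" using t f_pos f1_pos f1_le_1[of t] f2_pos[of t] by auto
      have Qpos: "0 < Q t" using F by (simp add: Q_def)
      define th where "th = \<theta> x"
      define \<mu> where "\<mu> = M * (x + A) powr (- c)"
      have th: "0 < th" using \<theta>pos x by (simp add: th_def)
      have "0 \<le> th * Q t" using th Qpos by simp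
      note ex = ratio_excess[of r "(f1 t)\<^sup>2" "th * Q t", OF r _ this]
      have r1: "1 < r" and gap: "th * Q t \<le> (r - 1) * (r + 1) * (f1 t)\<^sup>2"
        using ex pos F by (auto simp: th_def)
      have small: "(r - 1) * t\<^sup>2 \<le> \<mu> / (2 * b)"
      proof -
        have den: "0 < 1 + b * t\<^sup>2" using b by (simp add: add_pos_nonneg)
        have "r\<^sup>2 * (f1 t)\<^sup>2 \<le> (f1 t)\<^sup>2 + \<mu> * ((f1 t)\<^sup>2 * (1 / (1 + b * t\<^sup>2)))"
          using decay[of x y] x y F by (simp add: re te \<mu>_def power_divide)
        also have "\<dots> = (1 + \<mu> / (1 + b * t\<^sup>2)) * (f1 t)\<^sup>2" by (simp add: algebra_simps)
        finally have "r\<^sup>2 \<le> 1 + \<mu> / (1 + b * t\<^sup>2)" using F by simp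
        then have "(r - 1) * (r + 1) * (1 + b * t\<^sup>2) \<le> \<mu>"
          using den by (simp add: field_simps power2_eq_square)
        moreover have "(r - 1) * 2 * (b * t\<^sup>2) \<le> (r - 1) * (r + 1) * (1 + b * t\<^sup>2)"
          using r1 b by (intro mult_mono) auto
        ultimately show ?thesis using b by (simp add: field_simps)
      qed
      define h where "h = f t * f2 t / f1 t"
      have h: "0 \<le> h" "h \<le> f1 t" "h * f1 t = Q t"
        using f_f2_le[of t] t F by (auto simp: h_def Q_def field_simps power2_eq_square)
      have fsq: "(f t)\<^sup>2 \<le> t\<^sup>2 * f1 t"
      proof -
        have "f t \<le> t * f1 t" using f_le_f1[of t] t by simp
        then have "(f t)\<^sup>2 \<le> (t * f1 t)\<^sup>2" using F by (intro power_mono) auto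
        also have "\<dots> = t\<^sup>2 * (f1 t * f1 t)" by (simp add: power2_eq_square)
        also have "\<dots> \<le> t\<^sup>2 * (f1 t * 1)" using F by (intro mult_left_mono) auto
        also have "\<dots> = t\<^sup>2 * f1 t" by simp
        finally show ?thesis .
      qed
      have gain: "2 * th * h \<le> 2 * (r - 1) * f1 t * (r + 1)"
      proof -
        have "th * h * f1 t \<le> (r - 1) * (r + 1) * f1 t * f1 t"
          using gap h(3) by (simp add: power2_eq_square mult.assoc)
        then have "th * h \<le> (r - 1) * (r + 1) * f1 t" using F(2) by (rule mult_right_le_imp_le)
        then show ?thesis by (simp add: algebra_simps)
      qed
      have "0 \<le> 2 * (r - 1) * f1 t + th * ((- 2 + \<mu> / (2 * b)) * f1 t - (f1 t - (f t)\<^sup>2)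
           - r * (- 3 * f1 t + (f t)\<^sup>2 + h))"
      proof -
        have "(r - 1) * (f t)\<^sup>2 \<le> (r - 1) * (t\<^sup>2 * f1 t)" using r1 fsq by (intro mult_left_mono) auto
        also have "\<dots> = (r - 1) * t\<^sup>2 * f1 t" by simp
        also have "\<dots> \<le> \<mu> / (2 * b) * f1 t" using small F by (intro mult_right_mono) auto
        finally have 1: "0 \<le> \<mu> / (2 * b) * f1 t - (r - 1) * (f t)\<^sup>2" by simp
        have "(r - 1) * h * (r + 2) \<le> (r - 1) * f1 t * (3 * (r + 1))"
          using r1 h F by (intro mult_mono) auto
        then have 2: "0 \<le> 3 * ((r - 1) * f1 t) * (r + 1) - (r - 1) * h * (r + 2)"
          by (simp add: algebra_simps)
        have "0 \<le> (2 * (r - 1) * f1 t * (r + 1) - 2 * th * h)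
          + th * ((\<mu> / (2 * b) * f1 t - (r - 1) * (f t)\<^sup>2) * (r + 1)
            + (3 * ((r - 1) * f1 t) * (r + 1) - (r - 1) * h * (r + 2)))"
          using gain 1 2 th r1 by (intro add_nonneg_nonneg mult_nonneg_nonneg) auto
        also have "\<dots> = (2 * (r - 1) * f1 t + th * ((- 2 + \<mu> / (2 * b)) * f1 t - (f1 t - (f t)\<^sup>2)
           - r * (- 3 * f1 t + (f t)\<^sup>2 + h))) * (r + 1)"
          by (simp add: algebra_simps power2_eq_square)
        finally show ?thesis using r1 by (simp add: zero_le_mult_iff)
      qed
      then have "0 \<le> Q t * (2 * (r - 1) * f1 t + th * ((- 2 + \<mu> / (2 * b)) * f1 t - (f1 t - (f t)\<^sup>2)
           - r * (- 3 * f1 t + (f t)\<^sup>2 + h)))" using Qpos by simp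
      also have "\<dots> = f1 t * (2 * (- 1 + \<mu> / (4 * b)) * th) * Q t - f t * (2 * f1 t * f2 t + th * Q1 t)
        - r * ((2 * (f2 t)\<^sup>2 - 2 * f t * f1 t * f2 t - f2 t / f1 t * (2 * f1 t * f2 t))
           + th * (Q2 t - f2 t / f1 t * Q1 t))"
        unfolding Q_def Q1_def Q2_def h_def using F(2) b
        by (simp add: field_simps power2_eq_square power3_eq_cube)
      also have "2 * (- 1 + \<mu> / (4 * b)) * th = 2 * (x + A) * \<theta>' x"
      proof -
        have gen: "2 * w * q = 2 * z * (q * w / z)" if "0 < z" for w q z :: real using that by simp
        have "0 < x + A" using x A by simp
        from gen[OF this] show ?thesis unfolding \<theta>'_def th_def \<mu>_def .
      qed
      finally show "0 \<le> 1 * (2 * (x + A) * f1 t * \<theta>' x * Q t - f t * (2 * f1 t * f2 t + \<theta> x * Q1 t)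
        - r * (2 * (f2 t)\<^sup>2 - 2 * f t * f1 t * f2 t + \<theta> x * Q2 t - f2 t / f1 t * (2 * f1 t * f2 t + \<theta> x * Q1 t)))"
        unfolding th_def by (simp add: algebra_simps)
    qed (use xy d\<theta> dQ dQ1 f1_square_deriv f1_square_cont f1_square_le_1 in auto)
    then have "(u x y)\<^sup>2 \<le> (f1 (eta A x y))\<^sup>2 + \<theta> x * Q (eta A x y)" by simp
    also have "\<theta> x * Q (eta A x y) \<le> K / (x + A) * Q (eta A x y)"
      using \<theta>le[OF xy(1)] f_nonneg[of "eta A x y"] f2_pos[of "eta A x y"] eta_nonneg[OF A xy]
      by (intro mult_right_mono) (auto simp: Q_def)
    finally show ?thesis by (simp add: Q_def)
  qed
  then show ?thesis using that K by blast
qed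

end

end

section \<open>The initial datum between two Blasius profiles\<close>

context oleinik_flow begin

lemma u_linear_lower_initial:
  assumes Y: "0 < Y" obtains k where "0 < k" "\<And>y. 0 \<le> y \<Longrightarrow> y \<le> Y \<Longrightarrow> k * y \<le> u 0 y"
proof -
  have "\<exists>m>0. \<exists>y0>0. \<forall>x\<in>{0..1::real}. \<forall>y. 0 < y \<and> y < y0 \<longrightarrow> Dy u x y > m"
    using solution unfolding oleinik_solution_def by (metis zero_less_one)
  then obtain m y0 where m: "0 < m" "0 < y0" "\<And>y. 0 < y \<Longrightarrow> y < y0 \<Longrightarrow> m < Dy u 0 y"
    by (metis atLeastAtMost_iff order_refl zero_le_one)
  have near: "m * y \<le> u 0 y" if "0 \<le> y" "y < y0" for y
  proof -
    have "u 0 0 - m * 0 \<le> u 0 y - m * y"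
    proof (rule DERIV_nonneg_imp_increasing_open[where f = "\<lambda>y. u 0 y - m * y", OF that(1)])
      show "\<exists>d. ((\<lambda>y. u 0 y - m * y) has_real_derivative d) (at s) \<and> 0 \<le> d" if s: "0 < s" "s < y" for s
        using s m(3)[of s] \<open>y < y0\<close>
        by (intro exI[of _ "Dy u 0 s - m"]) (auto intro!: derivative_eq_intros u_deriv_y)
      show "continuous_on {0..y} (\<lambda>y. u 0 y - m * y)"
        by (intro continuous_intros continuous_on_subset[OF u_cont_y]) auto
    qed
    then show ?thesis using u_wall[of 0] by simp
  qed
  define y1 where "y1 = min (y0 / 2) Y"
  have y1: "0 < y1" "y1 < y0" "y1 \<le> Y" using m Y by (auto simp: y1_def)
  have "continuous_on {y1..Y} (u 0)" by (rule continuous_on_subset[OF u_cont_y]) (use y1 in auto)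
  then obtain z where z: "z \<in> {y1..Y}" "\<And>y. y \<in> {y1..Y} \<Longrightarrow> u 0 z \<le> u 0 y"
    using continuous_attains_inf[of "{y1..Y}" "u 0"] y1 by auto
  have uz: "0 < u 0 z" using u_pos[of 0 z] z y1 by simp
  show ?thesis
  proof (rule that[of "min m (u 0 z / Y)"])
    show "0 < min m (u 0 z / Y)" using m uz Y by simp
    fix y assume y: "0 \<le> y" "y \<le> Y"
    show "min m (u 0 z / Y) * y \<le> u 0 y"
    proof (cases "y < y0 \<and> y \<le> y1")
      case True
      have "min m (u 0 z / Y) * y \<le> m * y" using y by (intro mult_right_mono) auto
      then show ?thesis using near[of y] True y by simp
    next
      case False
      have "min m (u 0 z / Y) * y \<le> u 0 z / Y * Y" using y Y uz by (intro mult_mono) (auto intro: less_imp_le)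
      also have "\<dots> = u 0 z" using Y by simp
      also have "\<dots> \<le> u 0 y" using z(2)[of y] False y y1 by auto
      finally show ?thesis .
    qed
  qed
qed

lemma psi_initial_le:
  assumes "\<And>y. 0 \<le> y \<Longrightarrow> u 0 y \<le> M" "0 \<le> y" shows "psi 0 y \<le> M * y"
  by (rule half_line_compare[where g = "psi 0" and k = "\<lambda>y. M * y" and g' = "u 0" and k' = "\<lambda>_. M"])
    (use assms in \<open>auto intro!: derivative_eq_intros continuous_intros psi_cont_y psi_deriv_y\<close>)

lemma psi_initial_le_square:
  assumes "\<And>y. 0 \<le> y \<Longrightarrow> u 0 y \<le> L * y" "0 \<le> y" shows "psi 0 y \<le> L * y\<^sup>2 / 2"
  by (rule half_line_compare[where g = "psi 0" and k = "\<lambda>y. L * y\<^sup>2 / 2" and g' = "u 0" and k' = "\<lambda>y. L * y"])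
    (use assms in \<open>auto intro!: derivative_eq_intros continuous_intros psi_cont_y psi_deriv_y\<close>)

lemma psi_initial_ge_square:
  assumes "\<And>y. 0 \<le> y \<Longrightarrow> y \<le> Y \<Longrightarrow> k * y \<le> u 0 y" "0 \<le> y" "y \<le> Y" shows "k * y\<^sup>2 / 2 \<le> psi 0 y"
proof -
  have "psi 0 0 - k * 0\<^sup>2 / 2 \<le> psi 0 y - k * y\<^sup>2 / 2"
  proof (rule DERIV_nonneg_imp_increasing_open[where f = "\<lambda>y. psi 0 y - k * y\<^sup>2 / 2", OF assms(2)])
    show "\<exists>d. ((\<lambda>y. psi 0 y - k * y\<^sup>2 / 2) has_real_derivative d) (at s) \<and> 0 \<le> d" if s: "0 < s" "s < y" for s
      using s assms
      by (intro exI[of _ "u 0 s - k * s"]) (auto intro!: derivative_eq_intros psi_deriv_y)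
    show "continuous_on {0..y} (\<lambda>y. psi 0 y - k * y\<^sup>2 / 2)"
      by (intro continuous_intros continuous_on_subset[OF psi_cont_y]) auto
  qed
  then show ?thesis by simp
qed

end

context blasius_comparison begin

text \<open>
  A large \<open>A\<close> makes the Blasius profile of origin \<open>- A\<close> thick: it is slow near the wall, and its
  Gaussian tail is wider than that of the datum. The generator \<open>f f''\<close> inherits this tail.
\<close>

lemma initial_sandwich:
  assumes \<epsilon>: "0 < \<epsilon>" and tail: "\<And>y. y \<ge> 0 \<Longrightarrow> \<bar>u0 y - 1\<bar> \<le> C0 * exp (- \<epsilon> * y\<^sup>2)"
  obtains A N where "1 \<le> A" "0 < N"
    "\<And>y. 0 \<le> y \<Longrightarrow> (f1 (eta A 0 y))\<^sup>2 \<le> (u 0 y)\<^sup>2"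
    "\<And>y. 0 \<le> y \<Longrightarrow> (u 0 y)\<^sup>2 \<le> (f1 (eta A 0 y))\<^sup>2 + N * (f (eta A 0 y) * f2 (eta A 0 y))"
proof -
  have C0: "1 \<le> C0" using tail[of 0] u_initial[of 0] u_wall[of 0] by simp
  have tail': "\<bar>u 0 y - 1\<bar> \<le> C0 * exp (- \<epsilon> * y\<^sup>2)" if "0 \<le> y" for y
    using tail[OF that] u_initial[OF that] by simp
  obtain M where M: "1 \<le> M" "\<And>y. 0 \<le> y \<Longrightarrow> u 0 y \<le> M"
    using u_bounded[of 1] by (metis order_refl zero_le_one zero_less_one)
  obtain L where L: "0 < L" "\<And>y. 0 \<le> y \<Longrightarrow> u 0 y \<le> L * y" using u_lipschitz_initial by blast
  define a where "a = f2 0"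
  have a: "0 < a" using f2_pos[of 0] by (simp add: a_def)
  define g where "g = f1 1"
  have g: "0 < g" using f1_pos[of 1] by (simp add: g_def)
  (* beyond Y, half of the exponent of the tail absorbs the constants C0 and a * exp (- 4) *)
  define Y where "Y = max 1 (2 * C0 * exp 4 / (a * \<epsilon>))"
  have Y: "1 \<le> Y" "2 * C0 * exp 4 / (a * \<epsilon>) \<le> Y" by (auto simp: Y_def)
  have far: "C0 * exp (- \<epsilon> * y\<^sup>2) \<le> a * exp (- (4 + \<epsilon> * y\<^sup>2 / 2))" if "Y \<le> y" for y
  proof -
    have y1: "1 \<le> y" using that Y by simp
    have "2 * C0 * exp 4 / (a * \<epsilon>) \<le> y" using Y(2) that by simp
    then have "2 * C0 * exp 4 \<le> a * \<epsilon> * y" using a \<epsilon> by (simp add: pos_divide_le_eq mult.commute)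
    also have "\<dots> \<le> a * \<epsilon> * y\<^sup>2" using y1 a \<epsilon> by (simp add: power2_eq_square)
    finally have "C0 * exp 4 \<le> a * (\<epsilon> * y\<^sup>2 / 2)" by simp
    also have "\<dots> \<le> a * exp (\<epsilon> * y\<^sup>2 / 2)"
    proof (rule mult_left_mono)
      show "\<epsilon> * y\<^sup>2 / 2 \<le> exp (\<epsilon> * y\<^sup>2 / 2)"
        using exp_ge_add_one_self[of "\<epsilon> * y\<^sup>2 / 2"] by linarith
    qed (use a in simp)
    finally have "C0 * exp 4 * (exp (- \<epsilon> * y\<^sup>2) * exp (- 4)) \<le> a * exp (\<epsilon> * y\<^sup>2 / 2) * (exp (- \<epsilon> * y\<^sup>2) * exp (- 4))"
      by (intro mult_right_mono) auto
    moreover have "C0 * exp 4 * (exp (- \<epsilon> * y\<^sup>2) * exp (- 4)) = C0 * exp (- \<epsilon> * y\<^sup>2)"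
      by (simp add: exp_minus)
    moreover have "exp (\<epsilon> * y\<^sup>2 / 2) * (exp (- \<epsilon> * y\<^sup>2) * exp (- 4)) = exp (- (4 + \<epsilon> * y\<^sup>2 / 2))"
      by (simp add: exp_add[symmetric] field_simps)
    ultimately show ?thesis by (simp only: mult.assoc)
  qed
  obtain k where k: "0 < k" "\<And>y. 0 \<le> y \<Longrightarrow> y \<le> Y \<Longrightarrow> k * y \<le> u 0 y"
    using u_linear_lower_initial[of Y] Y by auto
  (* the second bound widens the Gaussian of the profile beyond that of the datum,
     the third makes the profile slow on [0, Y] *)
  define A where "A = max 1 (max (M\<^sup>2 / (g\<^sup>2 * \<epsilon>)) ((a * L / k\<^sup>2)\<^sup>2))"
  have A1: "1 \<le> A" and A2: "M\<^sup>2 / (g\<^sup>2 * \<epsilon>) \<le> A" and A3: "(a * L / k\<^sup>2)\<^sup>2 \<le> A"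
    by (auto simp: A_def)
  define S where "S = sqrt (2 * A)"
  have S: "0 < S" "S\<^sup>2 = 2 * A" using A1 by (auto simp: S_def)
  have A0: "0 < A" using A1 by simp
  define e where "e y = eta A 0 y" for y
  have e0: "0 \<le> e y" if "0 \<le> y" for y using eta_nonneg[OF A0] that by (simp add: e_def)
  have fe: "f (e y) = psi 0 y / S" if "0 \<le> y" for y using f_eta[OF A0, of 0 y] that by (simp add: e_def S_def)
  have emono: "e y \<le> e z" if "0 \<le> y" "y \<le> z" for y z
    unfolding e_def eta_def using that S psi_nonneg[of 0 y] psi_mono[of 0 y z]
    by (intro finv_mono divide_right_mono) (auto simp: S_def)
  have egrow: "(e y + 1)\<^sup>2 / 2 \<le> 4 + \<epsilon> * y\<^sup>2 / 2" if y: "0 \<le> y" for y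
  proof -
    define z where "z = M * y / (g * S)"
    have "g * (e y - 1) \<le> M * y / S"
      using f_tangent[OF e0[OF y]] fe[OF y] divide_right_mono[OF psi_initial_le[OF M(2) y], of S] S
      by (simp add: g_def)
    then have "e y - 1 \<le> z" using g S by (simp add: z_def field_simps)
    then have "(e y + 1)\<^sup>2 \<le> (z + 2)\<^sup>2" using e0[OF y] by (intro power_mono) auto
    moreover have "0 \<le> (z - 2)\<^sup>2" by simp
    ultimately have "(e y + 1)\<^sup>2 / 2 \<le> 4 + z\<^sup>2" by (simp add: power2_eq_square algebra_simps)
    also have "z\<^sup>2 \<le> \<epsilon> * y\<^sup>2 / 2"
    proof -
      have "M\<^sup>2 \<le> A * (g\<^sup>2 * \<epsilon>)" using A2 g \<epsilon> by (simp add: field_simps)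
      then have "M\<^sup>2 * y\<^sup>2 \<le> A * (g\<^sup>2 * \<epsilon>) * y\<^sup>2" by (rule mult_right_mono) simp
      then show ?thesis unfolding z_def power_divide power_mult_distrib S(2)
        using g A0 by (simp add: field_simps)
    qed
    finally show ?thesis by simp
  qed
  have lower: "(f1 (e y))\<^sup>2 \<le> (u 0 y)\<^sup>2" if y: "0 \<le> y" for y
  proof (cases "y \<le> Y")
    case True
    have "a * L / k\<^sup>2 \<le> S"
    proof (rule power2_le_imp_le)
      show "(a * L / k\<^sup>2)\<^sup>2 \<le> S\<^sup>2" using A3 A0 S by simp
    qed (use S in simp)
    then have aL: "a * L \<le> S * k\<^sup>2" using k by (simp add: field_simps)
    have "(f1 (e y))\<^sup>2 \<le> 2 * a * f (e y)" using f1_square_le[OF e0[OF y]] by (simp add: a_def)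
    also have "\<dots> = 2 * a * psi 0 y / S" using fe[OF y] by simp
    also have "\<dots> \<le> 2 * a * (L * y\<^sup>2 / 2) / S"
      using psi_initial_le_square[OF L(2) y] a S by (intro divide_right_mono mult_left_mono) auto
    also have "\<dots> = a * L * y\<^sup>2 / S" by simp
    also have "\<dots> \<le> S * k\<^sup>2 * y\<^sup>2 / S" using aL S by (intro divide_right_mono mult_right_mono) auto
    also have "\<dots> = (k * y)\<^sup>2" using S by (simp add: power_mult_distrib)
    also have "\<dots> \<le> (u 0 y)\<^sup>2" using k True y by (intro power_mono) auto
    finally show ?thesis .
  next
    case False
    have "a * exp (- (4 + \<epsilon> * y\<^sup>2 / 2)) \<le> a * exp (- ((e y + 1)\<^sup>2 / 2))"
      using egrow[OF y] a by (intro mult_left_mono) auto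
    then have "C0 * exp (- \<epsilon> * y\<^sup>2) \<le> 1 - f1 (e y)"
      using far[of y] False f1_deficit_lower[OF e0[OF y]] by (simp add: a_def)
    then have "f1 (e y) \<le> u 0 y" using tail'[OF y] by linarith
    then show ?thesis using f1_nonneg[OF e0[OF y]] by (intro power_mono) auto
  qed
  define h where "h = e 1"
  have h: "0 < h" using eta_pos[OF A0, of 0 1] by (simp add: h_def e_def)
  have fh: "0 < f h" "0 < f2 h" using h f_pos f2_pos[of h] by auto
  define N1 N2 N3 where "N1 = 2 * L\<^sup>2 / k * S / f2 h" and "N2 = 2 / (f h)\<^sup>2"
    and "N3 = (M + 1) * C0 / (f h * a * exp (- 4))"
  have N: "0 < N1" "0 < N2" "0 < N3" using L k S fh M C0 a by (auto simp: N1_def N2_def N3_def)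
  have upper: "(u 0 y)\<^sup>2 \<le> (f1 (e y))\<^sup>2 + (N1 + N2 + N3) * (f (e y) * f2 (e y))" if y: "0 \<le> y" for y
  proof -
    have G: "0 \<le> f (e y) * f2 (e y)" using f_nonneg f2_pos[of "e y"] e0[OF y] by simp
    show ?thesis
    proof (cases "y \<le> 1")
      case True
      have "k * y\<^sup>2 / 2 \<le> psi 0 y" using psi_initial_ge_square[OF k(2) y] True Y by simp
      then have "y\<^sup>2 \<le> 2 / k * (S * f (e y))" using fe[OF y] k S by (simp add: field_simps)
      then have "L\<^sup>2 * y\<^sup>2 \<le> L\<^sup>2 * (2 / k * (S * f (e y)))" by (rule mult_left_mono) simp
      moreover have "(u 0 y)\<^sup>2 \<le> (L * y)\<^sup>2" using L(2)[OF y] u_nonneg[of 0 y] y by (intro power_mono) auto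
      ultimately have "(u 0 y)\<^sup>2 \<le> 2 * L\<^sup>2 / k * S * f (e y) * 1" by (simp add: power_mult_distrib mult_ac)
      also have "\<dots> \<le> 2 * L\<^sup>2 / k * S * f (e y) * (f2 (e y) / f2 h)"
      proof (rule mult_left_mono)
        show "1 \<le> f2 (e y) / f2 h"
          using f2_antimono[of "e y" h] e0[OF y] emono[OF y True] fh by (simp add: h_def)
      qed (use L k S f_nonneg e0[OF y] in auto)
      also have "\<dots> = N1 * (f (e y) * f2 (e y))" by (simp add: N1_def)
      also have "\<dots> \<le> (N1 + N2 + N3) * (f (e y) * f2 (e y))" using N G by (intro mult_right_mono) auto
      finally show ?thesis by (smt (verit) zero_le_power2)
    next
      case False
      have he: "h \<le> e y" using emono[of 1 y] False by (simp add: h_def)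
      have fhe: "f h \<le> f (e y)" using f_mono[of h "e y"] h he by simp
      have f2e: "0 < f2 (e y)" using f2_pos e0[OF y] by simp
      have "1 - (f1 (e y))\<^sup>2 = (1 + f1 (e y)) * (1 - f1 (e y))" by (simp add: power2_eq_square algebra_simps)
      also have "\<dots> \<le> 2 * (f2 (e y) / f h)"
        using f1_deficit_upper[OF h he] f1_le_1[OF e0[OF y]] f1_nonneg[OF e0[OF y]] f2e fh
        by (intro mult_mono) auto
      also have "\<dots> = N2 * (f h * f2 (e y))" using fh by (simp add: N2_def power2_eq_square)
      also have "\<dots> \<le> N2 * (f (e y) * f2 (e y))" using N fhe f2e by (intro mult_left_mono mult_right_mono) auto
      finally have 1: "1 - (f1 (e y))\<^sup>2 \<le> N2 * (f (e y) * f2 (e y))" .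
      have "(u 0 y)\<^sup>2 - 1 = (u 0 y + 1) * (u 0 y - 1)" by (simp add: power2_eq_square algebra_simps)
      also have "\<dots> \<le> (M + 1) * (C0 * exp (- \<epsilon> * y\<^sup>2))"
      proof -
        have "(u 0 y + 1) * (u 0 y - 1) \<le> (u 0 y + 1) * (C0 * exp (- \<epsilon> * y\<^sup>2))"
          using tail'[OF y] u_nonneg[of 0 y] y by (intro mult_left_mono) auto
        also have "\<dots> \<le> (M + 1) * (C0 * exp (- \<epsilon> * y\<^sup>2))"
          using M(2)[OF y] C0 by (intro mult_right_mono) auto
        finally show ?thesis .
      qed
      also have "\<dots> = N3 * (f h * (a * (exp (- 4) * exp (- \<epsilon> * y\<^sup>2))))"
        using fh a by (simp add: N3_def)
      also have "\<dots> \<le> N3 * (f (e y) * f2 (e y))"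
      proof -
        have "exp (- 4) * exp (- \<epsilon> * y\<^sup>2) \<le> exp (- ((e y)\<^sup>2 / 2))"
        proof -
          have "(e y)\<^sup>2 \<le> (e y + 1)\<^sup>2" using e0[OF y] by (intro power_mono) auto
          moreover have "\<epsilon> * y\<^sup>2 / 2 \<le> \<epsilon> * y\<^sup>2" using \<epsilon> by simp
          ultimately have "- 4 + - \<epsilon> * y\<^sup>2 \<le> - ((e y)\<^sup>2 / 2)" using egrow[OF y] by simp
          then show ?thesis unfolding exp_add[symmetric] by simp
        qed
        then have "a * (exp (- 4) * exp (- \<epsilon> * y\<^sup>2)) \<le> a * exp (- ((e y)\<^sup>2 / 2))"
          using a by (intro mult_left_mono) auto
        also have "\<dots> \<le> f2 (e y)" using f2_gauss_lower[OF e0[OF y]] by (simp add: a_def)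
        finally have "f h * (a * (exp (- 4) * exp (- \<epsilon> * y\<^sup>2))) \<le> f (e y) * f2 (e y)"
          using fhe fh a f2e by (intro mult_mono) auto
        then show ?thesis using N by (intro mult_left_mono) auto
      qed
      finally have 2: "(u 0 y)\<^sup>2 - 1 \<le> N3 * (f (e y) * f2 (e y))" .
      have "0 \<le> N1 * (f (e y) * f2 (e y))" using N G by simp
      with 1 2 show ?thesis by (simp only: distrib_right)
    qed
  qed
  show ?thesis
    by (rule that[of A "N1 + N2 + N3"]) (use A1 N lower upper in \<open>auto simp: e_def\<close>)
qed

end

section \<open>Convergence to the Blasius flow\<close>

context blasius begin

lemma f1_concave:
  assumes "0 \<le> s" "s \<le> t" shows "f1 t - f1 s \<le> f2 s * (t - s)"
proof -
  have "f2 s * s - f1 s \<le> f2 s * t - f1 t"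
    by (rule half_line_mono[where a = s and h = "\<lambda>r. f2 s * r - f1 r" and h' = "\<lambda>r. f2 s - f2 r"])
      (use assms in \<open>auto intro!: derivative_eq_intros continuous_intros f1_deriv f2_antimono
        continuous_on_subset[OF f1_cont]\<close>)
  then show ?thesis by (simp add: algebra_simps)
qed

text \<open>Stretching the similarity variable by \<open>1 + q\<close> moves \<open>f'\<close> by at most \<open>q\<close>, since \<open>s f'' \<le> f' \<le> 1\<close>.\<close>

lemma f1_stretch:
  assumes "0 \<le> s" "s \<le> t" "t \<le> (1 + q) * s" "0 \<le> q"
  shows "f1 t - f1 s \<le> q"
proof -
  have "f1 t - f1 s \<le> f2 s * (t - s)" by (rule f1_concave[OF assms(1,2)])
  also have "\<dots> \<le> f2 s * (q * s)"
    using assms f2_pos[OF assms(1)] by (intro mult_left_mono) (auto simp: algebra_simps)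
  also have "\<dots> = q * (s * f2 s)" by simp
  also have "\<dots> \<le> q * 1"
    using f2_le_f1[OF assms(1)] f1_le_1[OF assms(1)] assms(4) by (intro mult_left_mono) auto
  finally show ?thesis by simp
qed

lemma f_f2_tail:
  obtains B where "0 < B" "\<And>t. 0 \<le> t \<Longrightarrow> f t * f2 t * (1 + t\<^sup>2) \<le> B * (f1 t)\<^sup>2"
proof -
  define c0 where "c0 = f2 1 * exp (f 1 / 2)"
  define p where "p = f 1"
  have pos: "0 < c0" "0 < p" "0 < f1 1" using f2_pos[of 1] f_pos[of 1] f1_pos[of 1] by (auto simp: c0_def p_def)
  define B where "B = 16 * c0 / (p\<^sup>2 * f1 1)"
  have B: "0 < B" using pos by (simp add: B_def)
  show ?thesis
  proof (rule that[of "2 + B"])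
    fix t :: real assume t: "0 \<le> t"
    show "f t * f2 t * (1 + t\<^sup>2) \<le> (2 + B) * (f1 t)\<^sup>2"
    proof (cases "t \<le> 1")
      case True
      have "f t * f2 t * (1 + t\<^sup>2) \<le> (f1 t)\<^sup>2 * 2"
        using f_f2_le[OF t] True t by (intro mult_mono) (auto simp: power_le_one)
      moreover have "(f1 t)\<^sup>2 * 2 \<le> (2 + B) * (f1 t)\<^sup>2"
        unfolding mult.commute[of _ 2] using B by (intro mult_right_mono) auto
      ultimately show ?thesis by (rule order_trans)
    next
      case False
      then have t1: "1 \<le> t" by simp
      have F: "0 < f1 t" "f1 1 \<le> f1 t" "0 < f2 t" using t1 f1_pos f1_mono[of 1 t] f2_pos[of t] by auto
      have sq: "1 + t\<^sup>2 \<le> 2 * t\<^sup>2" using t1 by simp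
      have "p\<^sup>2 * t^4 / 8 \<le> exp (p * t\<^sup>2 / 2)"
      proof -
        have "(p * t\<^sup>2 / 2)\<^sup>2 / 2 \<le> exp (p * t\<^sup>2 / 2)"
          using exp_lower_Taylor_quadratic[of "p * t\<^sup>2 / 2"] pos by (smt (verit) divide_nonneg_pos mult_nonneg_nonneg zero_le_power2)
        then show ?thesis by (simp add: power_divide power_mult_distrib)
      qed
      then have "p\<^sup>2 * t^4 / 8 * exp (- (p * t\<^sup>2 / 2)) \<le> 1" by (simp add: exp_minus field_simps)
      moreover have "t^3 \<le> t^4" using t1 by (intro power_increasing) auto
      ultimately have "p\<^sup>2 * t^3 / 8 * exp (- (p * t\<^sup>2 / 2)) \<le> 1"
        by (smt (verit) divide_right_mono exp_ge_zero mult_left_mono mult_right_mono zero_le_power2)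
      then have ex: "t^3 * exp (- (p * t\<^sup>2 / 2)) \<le> 8 / p\<^sup>2" using pos by (simp add: field_simps)
      have "f t * f2 t * (1 + t\<^sup>2) \<le> t * f1 t * f2 t * (2 * t\<^sup>2)"
        using f_le_f1[OF t] F sq t by (intro mult_mono mult_right_mono) auto
      also have "\<dots> = 2 * f1 t * (t^3 * f2 t)" by (simp add: power2_eq_square power3_eq_cube)
      also have "t^3 * f2 t \<le> t^3 * (c0 * exp (- (p * t\<^sup>2 / 2)))"
        using f2_gauss_upper[OF t1] t by (intro mult_left_mono) (auto simp: c0_def p_def)
      also have "\<dots> = c0 * (t^3 * exp (- (p * t\<^sup>2 / 2)))" by simp
      also have "\<dots> \<le> c0 * (8 / p\<^sup>2)" using ex pos by (intro mult_left_mono) auto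
      finally have "f t * f2 t * (1 + t\<^sup>2) \<le> 2 * f1 t * (c0 * (8 / p\<^sup>2))"
        using F by simp
      also have "\<dots> = B * f1 1 * f1 t" using pos by (simp add: B_def)
      also have "\<dots> \<le> B * f1 t * f1 t" using B F by (intro mult_right_mono mult_left_mono) auto
      also have "\<dots> \<le> (2 + B) * (f1 t)\<^sup>2" by (simp add: power2_eq_square algebra_simps)
      finally show ?thesis .
    qed
  qed (use B in simp)
qed

end

context blasius_comparison begin

lemma streamwise_decay:
  assumes \<epsilon>: "0 < \<epsilon>" and tail: "\<And>y. y \<ge> 0 \<Longrightarrow> \<bar>u0 y - 1\<bar> \<le> C0 * exp (- \<epsilon> * y\<^sup>2)"
  obtains A K where "1 \<le> A" "0 < K"
    "\<And>x y. 0 \<le> x \<Longrightarrow> 0 \<le> y \<Longrightarrow> (f1 (eta A x y))\<^sup>2 \<le> (u x y)\<^sup>2"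
    "\<And>x y. 0 \<le> x \<Longrightarrow> 0 \<le> y \<Longrightarrow>
      (u x y)\<^sup>2 \<le> (f1 (eta A x y))\<^sup>2 + K / (x + A) * (f (eta A x y) * f2 (eta A x y))"
proof -
  obtain A N where A: "1 \<le> A" and N: "0 < N"
    and low0: "\<And>y. 0 \<le> y \<Longrightarrow> (f1 (eta A 0 y))\<^sup>2 \<le> (u 0 y)\<^sup>2"
    and up0: "\<And>y. 0 \<le> y \<Longrightarrow> (u 0 y)\<^sup>2 \<le> (f1 (eta A 0 y))\<^sup>2 + N * (f (eta A 0 y) * f2 (eta A 0 y))"
    using initial_sandwich[OF \<epsilon> tail] by blast
  have A0: "0 < A" using A by simp
  have e0: "0 \<le> eta A x y" if "0 \<le> x" "0 \<le> y" for x y using eta_nonneg[OF A0 that] .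
  define R where "R = 1 + N"
  have R: "1 \<le> R" using N by (simp add: R_def)
  have "(u x y)\<^sup>2 \<le> R * (f1 (eta A x y))\<^sup>2" if "0 \<le> x" "0 \<le> y" for x y
  proof (rule blasius_multiple_upper_bound[OF A0 R _ that])
    fix y :: real assume y: "0 \<le> y"
    have "N * (f (eta A 0 y) * f2 (eta A 0 y)) \<le> N * (f1 (eta A 0 y))\<^sup>2"
      using f_f2_le[OF e0[of 0 y]] y N by (intro mult_left_mono) auto
    then show "(u 0 y)\<^sup>2 \<le> R * (f1 (eta A 0 y))\<^sup>2" using up0[OF y] by (simp add: R_def algebra_simps)
  qed
  moreover have "R * z \<le> R\<^sup>2 * z" if "0 \<le> z" for z
    using R that by (intro mult_right_mono) (auto simp: power2_eq_square)
  ultimately have crude: "(u x y)\<^sup>2 \<le> R\<^sup>2 * (f1 (eta A x y))\<^sup>2" if "0 \<le> x" "0 \<le> y" for x y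
    using that by (meson order_trans zero_le_power2)
  obtain b c where b: "0 < b" "b \<le> 1/2" and c: "0 < c" and weight: "\<And>t r. 0 < t \<Longrightarrow> 1 \<le> r \<Longrightarrow> r \<le> R \<Longrightarrow>
      2 * c * (f1 t)\<^sup>2 * (1 / (1 + b * t\<^sup>2))
        + r * f1 t * (8 * b\<^sup>2 * t\<^sup>2 * (1 / (1 + b * t\<^sup>2))^3 - 2 * b * (1 / (1 + b * t\<^sup>2))\<^sup>2)
      \<le> f t * f2 t * (1 / (1 + b * t\<^sup>2))
        + (f t * f1 t + 3 * r * f2 t) * (2 * b * t * (1 / (1 + b * t\<^sup>2))\<^sup>2)"
    using weight_inequality[OF R] by metis
  obtain B where B: "0 < B" "\<And>t. 0 \<le> t \<Longrightarrow> f t * f2 t * (1 + t\<^sup>2) \<le> B * (f1 t)\<^sup>2"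
    using f_f2_tail by blast
  define M where "M = N * B * A powr c"
  have M: "0 < M" using N B A by (simp add: M_def)
  have init: "(u 0 y)\<^sup>2 \<le> (f1 (eta A 0 y))\<^sup>2
      + M * A powr (- c) * ((f1 (eta A 0 y))\<^sup>2 * (1 / (1 + b * (eta A 0 y)\<^sup>2)))" if y: "0 \<le> y" for y
  proof -
    define t where "t = eta A 0 y"
    have t: "0 \<le> t" using e0 y by (simp add: t_def)
    have den: "0 < 1 + b * t\<^sup>2" using b by (simp add: add_pos_nonneg)
    have "f t * f2 t * (1 + b * t\<^sup>2) \<le> f t * f2 t * (1 + t\<^sup>2)"
      using b f_nonneg[OF t] f2_pos[OF t] by (intro mult_left_mono) (auto simp: mult_left_le_one_le)
    also have "\<dots> \<le> B * (f1 t)\<^sup>2" by (rule B(2)[OF t])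
    finally have "f t * f2 t \<le> B * (f1 t)\<^sup>2 / (1 + b * t\<^sup>2)" using den by (simp add: field_simps)
    then have "N * (f t * f2 t) \<le> N * (B * (f1 t)\<^sup>2 / (1 + b * t\<^sup>2))" using N by (intro mult_left_mono) auto
    also have "\<dots> = M * A powr (- c) * ((f1 t)\<^sup>2 * (1 / (1 + b * t\<^sup>2)))"
      using A0 by (simp add: M_def powr_minus)
    finally show ?thesis using up0[OF y] by (simp add: t_def)
  qed
  have decay: "(u x y)\<^sup>2 \<le> (f1 (eta A x y))\<^sup>2
      + M * (x + A) powr (- c) * ((f1 (eta A x y))\<^sup>2 * (1 / (1 + b * (eta A x y)\<^sup>2)))"
    if "0 \<le> x" "0 \<le> y" for x y
    by (rule weighted_decay[OF A0 R crude b(1) c weight M init that])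
  obtain K where K: "0 < K" "\<And>x y. 0 \<le> x \<Longrightarrow> 0 \<le> y \<Longrightarrow>
      (u x y)\<^sup>2 \<le> (f1 (eta A x y))\<^sup>2 + K / (x + A) * (f (eta A x y) * f2 (eta A x y))"
    using sharp_decay[OF A0 b(1) c M N decay up0] by blast
  show ?thesis by (rule that[OF A K(1) blasius_lower_bound[OF A0 low0] K(2)])
qed

text \<open>
  Back to the physical variable: \<open>\<eta>\<^sub>y = u / (f'(\<eta>) sqrt (2 (x + A)))\<close>, so a relative error of \<open>u\<close> on
  each streamline is the same relative error of \<open>\<eta>\<close> against \<open>y / sqrt (2 (x + A))\<close>.
\<close>

lemma blasius_convergence:
  assumes \<epsilon>: "0 < \<epsilon>" and tail: "\<And>y. y \<ge> 0 \<Longrightarrow> \<bar>u0 y - 1\<bar> \<le> C0 * exp (- \<epsilon> * y\<^sup>2)"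
  obtains C where "0 < C" "\<And>x y. 0 < x \<Longrightarrow> 0 < y \<Longrightarrow> \<bar>u x y - blasius_flow f x y\<bar> \<le> C / (x + 1)"
proof -
  obtain A K where A: "1 \<le> A" and K: "0 < K"
    and low: "\<And>x y. 0 \<le> x \<Longrightarrow> 0 \<le> y \<Longrightarrow> (f1 (eta A x y))\<^sup>2 \<le> (u x y)\<^sup>2"
    and up: "\<And>x y. 0 \<le> x \<Longrightarrow> 0 \<le> y \<Longrightarrow>
      (u x y)\<^sup>2 \<le> (f1 (eta A x y))\<^sup>2 + K / (x + A) * (f (eta A x y) * f2 (eta A x y))"
    using streamwise_decay[OF \<epsilon> tail] by blast
  have A0: "0 < A" using A by simp
  show ?thesis
  proof (rule that[of "K + A"])
    show "0 < K + A" using A K by simp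
    fix x y :: real assume x: "0 < x" and y: "0 < y"
    define S where "S = sqrt (2 * (x + A))"
    have S: "0 < S" using x A by (simp add: S_def)
    define \<kappa> where "\<kappa> = K / (x + A)"
    have \<kappa>: "0 < \<kappa>" "\<kappa> \<le> K / (x + 1)"
      using K x A by (auto simp: \<kappa>_def intro!: divide_left_mono mult_pos_pos)
    have e: "0 \<le> eta A x z" if "0 \<le> z" for z using eta_nonneg[OF A0, of x z] x that by simp
    have ge: "f1 (eta A x z) \<le> u x z" if "0 \<le> z" for z
      using power2_le_imp_le[OF low[of x z]] u_nonneg[of x z] x that by simp
    have le: "u x z \<le> (1 + \<kappa> / 2) * f1 (eta A x z)" if "0 \<le> z" for z
    proof (rule power2_le_imp_le)
      let ?t = "eta A x z"
      have "(u x z)\<^sup>2 \<le> (f1 ?t)\<^sup>2 + \<kappa> * (f ?t * f2 ?t)" using up[of x z] x that by (simp add: \<kappa>_def)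
      also have "\<dots> \<le> (f1 ?t)\<^sup>2 + \<kappa> * (f1 ?t)\<^sup>2"
        using f_f2_le[OF e[OF that]] \<kappa> by (intro add_left_mono mult_left_mono) auto
      also have "\<dots> \<le> (f1 ?t)\<^sup>2 + \<kappa> * (f1 ?t)\<^sup>2 + (\<kappa> / 2)\<^sup>2 * (f1 ?t)\<^sup>2" by simp
      also have "\<dots> = ((1 + \<kappa> / 2) * f1 ?t)\<^sup>2" by (simp add: power2_eq_square algebra_simps)
      finally show "(u x z)\<^sup>2 \<le> ((1 + \<kappa> / 2) * f1 ?t)\<^sup>2" .
      show "0 \<le> (1 + \<kappa> / 2) * f1 ?t" using \<kappa> f1_nonneg[OF e[OF that]] by simp
    qed
    have ec: "continuous_on {0..} (eta A x)"
    proof -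
      have "continuous_on {0..} (\<lambda>z. (\<lambda>(x, y). eta A x y) (x, z))"
        by (rule continuous_on_compose2[OF eta_cont[OF A0, of x]]) (use x in \<open>auto intro!: continuous_intros\<close>)
      then show ?thesis by simp
    qed
    have ed: "(eta A x has_real_derivative u x z / (S * f1 (eta A x z))) (at z)" if "0 < z" for z
      using eta_deriv_y[OF A0, of x z] x that by (simp add: S_def)
    have f1e: "0 < f1 (eta A x z)" if "0 < z" for z using f1_pos[OF eta_pos[OF A0, of x z]] x that by simp
    have "1 / S * y \<le> eta A x y"
    proof (rule half_line_compare[where g = "\<lambda>z. 1 / S * z" and g' = "\<lambda>_. 1 / S" and k = "eta A x"
          and k' = "\<lambda>z. u x z / (S * f1 (eta A x z))"])
      show "1 / S \<le> u x z / (S * f1 (eta A x z))" if "0 < z" for z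
        using ge[of z] f1e[OF that] S that by (simp add: field_simps)
    qed (use ec ed y S in \<open>auto intro!: derivative_eq_intros continuous_intros\<close>)
    moreover have "eta A x y \<le> (1 + \<kappa> / 2) / S * y"
    proof (rule half_line_compare[where g = "eta A x" and k = "\<lambda>z. (1 + \<kappa> / 2) / S * z"
          and g' = "\<lambda>z. u x z / (S * f1 (eta A x z))" and k' = "\<lambda>_. (1 + \<kappa> / 2) / S"])
      show "u x z / (S * f1 (eta A x z)) \<le> (1 + \<kappa> / 2) / S" if "0 < z" for z
        using le[of z] f1e[OF that] S that by (simp add: field_simps)
    qed (use ec ed y S in \<open>auto intro!: derivative_eq_intros continuous_intros\<close>)
    moreover define \<zeta> where "\<zeta> = y / S"
    ultimately have ze: "0 \<le> \<zeta>" "\<zeta> \<le> eta A x y" "eta A x y \<le> (1 + \<kappa> / 2) * \<zeta>"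
      using y S by (auto simp: \<zeta>_def)
    have 1: "f1 (eta A x y) - f1 \<zeta> \<le> \<kappa> / 2" using f1_stretch[OF ze] \<kappa> by simp
    have 2: "f1 \<zeta> \<le> f1 (eta A x y)" using f1_mono ze by simp
    have 3: "u x y \<le> f1 (eta A x y) + \<kappa> / 2"
    proof -
      have "\<kappa> / 2 * f1 (eta A x y) \<le> \<kappa> / 2 * 1"
        using f1_le_1[OF e[of y]] y \<kappa> by (intro mult_left_mono) auto
      then show ?thesis using le[of y] y by (simp add: algebra_simps)
    qed
    define S1 where "S1 = sqrt (2 * (x + 1))"
    have S1: "0 < S1" "S1 \<le> S" using x A by (auto simp: S1_def S_def)
    have SS: "S \<le> (1 + (A - 1) / (x + 1)) * S1"
    proof (rule power2_le_imp_le)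
      define q where "q = (A - 1) / (x + 1)"
      have q: "0 \<le> q" using A x by (simp add: q_def)
      have "S\<^sup>2 = (1 + q) * S1\<^sup>2" using x A by (simp add: S_def S1_def q_def field_simps)
      also have "\<dots> \<le> (1 + q)\<^sup>2 * S1\<^sup>2" using q by (intro mult_right_mono) (auto simp: power2_eq_square)
      finally show "S\<^sup>2 \<le> ((1 + (A - 1) / (x + 1)) * S1)\<^sup>2" by (simp add: power_mult_distrib q_def)
      show "0 \<le> (1 + (A - 1) / (x + 1)) * S1" using q S1 by (simp add: q_def)
    qed
    have "y / S1 \<le> (1 + (A - 1) / (x + 1)) * \<zeta>"
    proof -
      have "y * S \<le> y * ((1 + (A - 1) / (x + 1)) * S1)" using SS y by (intro mult_left_mono) auto
      then show ?thesis using S S1 by (simp add: \<zeta>_def field_simps)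
    qed
    moreover have "\<zeta> \<le> y / S1" unfolding \<zeta>_def using S S1 y by (intro divide_left_mono) auto
    ultimately have 4: "f1 (y / S1) - f1 \<zeta> \<le> (A - 1) / (x + 1)" "f1 \<zeta> \<le> f1 (y / S1)"
      using f1_stretch[of \<zeta> "y / S1" "(A - 1) / (x + 1)"] f1_mono ze A x by auto
    have "\<bar>u x y - f1 (y / S1)\<bar> \<le> \<kappa> + (A - 1) / (x + 1)"
      using 1 2 3 4 ge[of y] y \<kappa> by linarith
    also have "\<dots> \<le> (K + A) / (x + 1)"
    proof -
      have "0 \<le> 1 / (x + 1)" using x by simp
      then show ?thesis using \<kappa>(2) unfolding add_divide_distrib diff_divide_distrib by linarith
    qed
    finally show "\<bar>u x y - blasius_flow f x y\<bar> \<le> (K + A) / (x + 1)" by (simp add: blasius_flow_def S1_def)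
  qed
qed

lemma Linf_norm_difference_le:
  assumes x: "0 < x" and bd: "\<And>y. 0 < y \<Longrightarrow> \<bar>u x y - blasius_flow f x y\<bar> \<le> c"
  shows "Linf_norm (\<lambda>y. u x y - blasius_flow f x y) \<le> ereal c"
  unfolding Linf_norm_def
proof (rule esssup_I)
  have "continuous_on {0<..} (\<lambda>y. f1 (y / sqrt (2 * (x + 1))))"
    by (rule continuous_on_compose2[OF f1_cont]) (use x in \<open>auto intro!: continuous_intros\<close>)
  then have "continuous_on {0<..} (\<lambda>y. \<bar>u x y - blasius_flow f x y\<bar>)"
    unfolding blasius_flow_def using x
    by (intro continuous_intros continuous_on_subset[OF u_cont_y]) auto
  then have "(\<lambda>y. \<bar>u x y - blasius_flow f x y\<bar>) \<in> borel_measurable (lebesgue_on {0<..})"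
    by (rule continuous_imp_measurable_on_sets_lebesgue) simp
  then show "(\<lambda>y. ereal \<bar>u x y - blasius_flow f x y\<bar>) \<in> borel_measurable (lebesgue_on {0<..})"
    by (rule borel_measurable_ereal)
  show "AE y in lebesgue_on {0<..}. ereal \<bar>u x y - blasius_flow f x y\<bar> \<le> ereal c"
    by (rule AE_I2) (use bd in auto)
qed

end

theorem theorem1p4:
  fixes u0 f :: "real \<Rightarrow> real"
    and u v :: "real \<Rightarrow> real \<Rightarrow> real"
    and \<epsilon> C0 :: real
  assumes "oleinik_datum u0"
    and "0 < \<epsilon>" and "\<epsilon> < 1"
    and "\<And>y. y \<ge> 0 \<Longrightarrow> \<bar>u0 y - 1\<bar> \<le> C0 * exp (- \<epsilon> * y\<^sup>2)"
    and "oleinik_solution u0 u v"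
    and "blasius_profile f"
  shows "\<exists>C>0. \<forall>x>0. Linf_norm (\<lambda>y. u x y - blasius_flow f x y) \<le> ereal (C / (x + 1))"
proof -
  interpret blasius_comparison f u0 u v
    by unfold_locales (fact assms)+
  obtain C where "0 < C" "\<And>x y. 0 < x \<Longrightarrow> 0 < y \<Longrightarrow> \<bar>u x y - blasius_flow f x y\<bar> \<le> C / (x + 1)"
    using blasius_convergence[OF assms(2,4)] by blast
  then show ?thesis using Linf_norm_difference_le by blast
qed

end
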